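(* Let $H$ be a left Hopf coquasigroup in $\mathsf{C}$ with left antipode $\lambda_H$. Let $J:K\to H\otimes H$ be a conormal twist, and let $H_J=(H,\eta_H,\mu_H,\varepsilon_H,\delta_{H_J})$ be the twist deformation of $H$ by $J$, which is a non-coassociative bimonoid. Then $H_J$ is a left Hopf coquasigroup with left antipode $$\lambda_{H_J}=\mu_H\circ(v_L\otimes(\mu_H\circ(\lambda_H\otimes v_L^{-1}))),$$ where $v_L=\mu_H\circ(H\otimes\lambda_H)\circ J^{-1}:K\to H$ and $v_L^{-1}=\mu_H\circ(\lambda_H\otimes H)\circ J:K\to H$.
   Context: $\mathsf{C}$ is a strict symmetric monoidal category with tensor product $\otimes$, unit object $K$ and symmetry $c$. For an object $P$ and a morphism $f$, write $P\otimes f$ for $\mathrm{id}_P\otimes f$ and $f\otimes P$ for $f\otimes \mathrm{id}_P$. For monoids $A,B$, the object $A\otimes B$ is a monoid with unit $\eta_A\otimes\eta_B$ and product $\mu_{A\otimes B}=(\mu_A\otimes\mu_B)\circ(A\otimes c_{B,A}\otimes B)$. A counital comagma is a triple $(D,\varepsilon_D,\delta_D)$ with $\varepsilon_D:D\to K$, $\delta_D:D\to D\otimes D$ such that $(\varepsilon_D\otimes D)\circ\delta_D=\mathrm{id}_D=(D\otimes\varepsilon_D)\circ\delta_D$ (no coassociativity required). A non-coassociative bimonoid is an object $H$ with a monoid structure $(H,\eta_H,\mu_H)$ (unital and associative) and a counital comagma structure $(H,\varepsilon_H,\delta_H)$ such that $\varepsilon_H\circ\eta_H=\mathrm{id}_K$,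 $\delta_H\circ\eta_H=\eta_H\otimes\eta_H$, $\varepsilon_H\circ\mu_H=\varepsilon_H\otimes\varepsilon_H$, and $\delta_H\circ\mu_H=\mu_{H\otimes H}\circ(\delta_H\otimes\delta_H)$. A left Hopf coquasigroup is a non-coassociative bimonoid $H$ for which there exists a morphism $\lambda_H:H\to H$ (the left antipode) such that $$(\mu_H\otimes H)\circ(\lambda_H\otimes\delta_H)\circ\delta_H=\eta_H\otimes H=(\mu_H\otimes H)\circ(H\otimes((\lambda_H\otimes H)\circ\delta_H))\circ\delta_H.$$ For a monoid $A$ and $f,g:K\to A$, the convolution product is $f\ast g=\mu_A\circ(f\otimes g)$; $f$ is convolution invertible if there is $f^{-1}:K\to A$ with $f\ast f^{-1}=f^{-1}\ast f=\eta_A$. A twist for $H$ is a convolution invertible morphism $J:K\to H\otimes H$ (convolution taken in the monoid $H\otimes H$), with inverse $J^{-1}$, such that, in the monoid $H\otimes H\otimes H$, $$((\delta_H\otimes H)\circ J)\ast(J\otimes\eta_H)=((H\otimes\delta_H)\circ J)\ast(\eta_H\otimes J).$$ $J$ is conormal if $(\varepsilon_H\otimes H)\circ J=\eta_H=(H\otimes\varepsilon_H)\circ J$. The coproduct of the twist deformation $H_J$ is $$\delta_{H_J}=\mu_{H\otimes H}\circ(\mu_{H\otimes H}\otimes H\otimes H)\circ(J^{-1}\otimes\delta_H\otimes J).$$ *)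

theory Defs
  imports Main
begin

section \<open>Strict symmetric monoidal categories\<close>

text \<open>
  Objects and arrows live in explicit carriers, and all operations are meaningful only on these
  carriers and on composable arrows. The notation \<open>\<otimes>\<close> is for the tensor product of arrows and
  \<open>\<otimes>\<^sub>o\<close> for that of objects; \<open>\<one> A\<close> is the identity arrow of \<open>A\<close>, \<open>\<K>\<close> is the unit object, and
  \<open>sym_arr C A B\<close> is the symmetry from \<open>A \<otimes>\<^sub>o B\<close> to \<open>B \<otimes>\<^sub>o A\<close>.
\<close>

record ('o, 'm) smcat =
  Obj :: "'o set"
  Arr :: "'m set"
  Dom :: "'m \<Rightarrow> 'o"
  Cod :: "'m \<Rightarrow> 'o"
  Id_arr :: "'o \<Rightarrow> 'm"  ("\<one>\<index>")
  comp_arr :: "'m \<Rightarrow> 'm \<Rightarrow> 'm"  (infixr "\<cdot>\<index>" 55)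
  tensor_obj :: "'o \<Rightarrow> 'o \<Rightarrow> 'o"  (infixr "\<otimes>\<^sub>o\<index>" 70)
  tensor_arr :: "'m \<Rightarrow> 'm \<Rightarrow> 'm"  (infixr "\<otimes>\<index>" 70)
  unit_obj :: "'o"  ("\<K>\<index>")
  sym_arr :: "'o \<Rightarrow> 'o \<Rightarrow> 'm"

definition hom :: "('o, 'm) smcat \<Rightarrow> 'o \<Rightarrow> 'o \<Rightarrow> 'm set" where
  "hom C A B = {f \<in> Arr C. Dom C f = A \<and> Cod C f = B}"

locale category =
  fixes C :: "('o, 'm) smcat" (structure)
  assumes Dom_Obj: "f \<in> Arr C \<Longrightarrow> Dom C f \<in> Obj C"
    and Cod_Obj: "f \<in> Arr C \<Longrightarrow> Cod C f \<in> Obj C"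
    and Id_hom: "A \<in> Obj C \<Longrightarrow> \<one> A \<in> hom C A A"
    and comp_hom: "\<lbrakk>f \<in> hom C A B; g \<in> hom C B D\<rbrakk> \<Longrightarrow> g \<cdot> f \<in> hom C A D"
    and comp_Id_left: "f \<in> hom C A B \<Longrightarrow> \<one> B \<cdot> f = f"
    and comp_Id_right: "f \<in> hom C A B \<Longrightarrow> f \<cdot> \<one> A = f"
    and comp_assoc: "\<lbrakk>f \<in> hom C A B; g \<in> hom C B D; h \<in> hom C D E\<rbrakk>
      \<Longrightarrow> (h \<cdot> g) \<cdot> f = h \<cdot> (g \<cdot> f)"

locale strict_monoidal_category = category +
  assumes unit_Obj: "\<K> \<in> Obj C"
    and tensor_Obj: "\<lbrakk>A \<in> Obj C; B \<in> Obj C\<rbrakk> \<Longrightarrow> A \<otimes>\<^sub>o B \<in> Obj C"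
    and tensor_hom: "\<lbrakk>f \<in> hom C A B; g \<in> hom C A' B'\<rbrakk>
      \<Longrightarrow> f \<otimes> g \<in> hom C (A \<otimes>\<^sub>o A') (B \<otimes>\<^sub>o B')"
    and tensor_Id: "\<lbrakk>A \<in> Obj C; B \<in> Obj C\<rbrakk> \<Longrightarrow> \<one> A \<otimes> \<one> B = \<one> (A \<otimes>\<^sub>o B)"
    and interchange: "\<lbrakk>f \<in> hom C A B; g \<in> hom C B D; f' \<in> hom C A' B'; g' \<in> hom C B' D'\<rbrakk>
      \<Longrightarrow> (g \<cdot> f) \<otimes> (g' \<cdot> f') = (g \<otimes> g') \<cdot> (f \<otimes> f')"
    and tensor_obj_assoc: "\<lbrakk>A \<in> Obj C; B \<in> Obj C; D \<in> Obj C\<rbrakk>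
      \<Longrightarrow> (A \<otimes>\<^sub>o B) \<otimes>\<^sub>o D = A \<otimes>\<^sub>o (B \<otimes>\<^sub>o D)"
    and unit_obj_left: "A \<in> Obj C \<Longrightarrow> \<K> \<otimes>\<^sub>o A = A"
    and unit_obj_right: "A \<in> Obj C \<Longrightarrow> A \<otimes>\<^sub>o \<K> = A"
    and tensor_arr_assoc: "\<lbrakk>f \<in> Arr C; g \<in> Arr C; h \<in> Arr C\<rbrakk>
      \<Longrightarrow> (f \<otimes> g) \<otimes> h = f \<otimes> (g \<otimes> h)"
    and unit_arr_left: "f \<in> Arr C \<Longrightarrow> \<one> \<K> \<otimes> f = f"
    and unit_arr_right: "f \<in> Arr C \<Longrightarrow> f \<otimes> \<one> \<K> = f"

text \<open>The second hexagon and \<open>sym_arr C A \<K> = \<one> A\<close> follow from the axioms below.\<close>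

locale strict_symmetric_monoidal_category = strict_monoidal_category +
  assumes sym_hom: "\<lbrakk>A \<in> Obj C; B \<in> Obj C\<rbrakk> \<Longrightarrow> sym_arr C A B \<in> hom C (A \<otimes>\<^sub>o B) (B \<otimes>\<^sub>o A)"
    and sym_natural: "\<lbrakk>f \<in> hom C A A'; g \<in> hom C B B'\<rbrakk>
      \<Longrightarrow> sym_arr C A' B' \<cdot> (f \<otimes> g) = (g \<otimes> f) \<cdot> sym_arr C A B"
    and sym_sym: "\<lbrakk>A \<in> Obj C; B \<in> Obj C\<rbrakk> \<Longrightarrow> sym_arr C B A \<cdot> sym_arr C A B = \<one> (A \<otimes>\<^sub>o B)"
    and hexagon: "\<lbrakk>A \<in> Obj C; B \<in> Obj C; D \<in> Obj C\<rbrakk>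
      \<Longrightarrow> sym_arr C A (B \<otimes>\<^sub>o D) = (\<one> B \<otimes> sym_arr C A D) \<cdot> (sym_arr C A B \<otimes> \<one> D)"


section \<open>Monoids, comagmas and bimonoids\<close>

record ('o, 'm) monoid_data =
  obj :: "'o"
  eta :: "'m"  ("\<eta>\<index>")
  mu :: "'m"  ("\<mu>\<index>")

record ('o, 'm) bimonoid_data = "('o, 'm) monoid_data" +
  eps :: "'m"  ("\<epsilon>\<index>")
  delta :: "'m"  ("\<delta>\<index>")

context
  fixes C :: "('o, 'm) smcat" (structure)
begin

definition monoid_in :: "('o, 'm, 'x) monoid_data_scheme \<Rightarrow> bool" where
  "monoid_in A \<longleftrightarrow>
     obj A \<in> Obj C \<and>
     \<eta>\<^bsub>A\<^esub> \<in> hom C \<K> (obj A) \<and>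
     \<mu>\<^bsub>A\<^esub> \<in> hom C (obj A \<otimes>\<^sub>o obj A) (obj A) \<and>
     \<mu>\<^bsub>A\<^esub> \<cdot> (\<eta>\<^bsub>A\<^esub> \<otimes> \<one> (obj A)) = \<one> (obj A) \<and>
     \<mu>\<^bsub>A\<^esub> \<cdot> (\<one> (obj A) \<otimes> \<eta>\<^bsub>A\<^esub>) = \<one> (obj A) \<and>
     \<mu>\<^bsub>A\<^esub> \<cdot> (\<mu>\<^bsub>A\<^esub> \<otimes> \<one> (obj A)) = \<mu>\<^bsub>A\<^esub> \<cdot> (\<one> (obj A) \<otimes> \<mu>\<^bsub>A\<^esub>)"

definition tensor_monoid ::
  "('o, 'm, 'x) monoid_data_scheme \<Rightarrow> ('o, 'm, 'y) monoid_data_scheme \<Rightarrow> ('o, 'm) monoid_data" where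
  "tensor_monoid A B =
     \<lparr>obj = obj A \<otimes>\<^sub>o obj B,
      eta = \<eta>\<^bsub>A\<^esub> \<otimes> \<eta>\<^bsub>B\<^esub>,
      mu = (\<mu>\<^bsub>A\<^esub> \<otimes> \<mu>\<^bsub>B\<^esub>) \<cdot> (\<one> (obj A) \<otimes> sym_arr C (obj B) (obj A) \<otimes> \<one> (obj B))\<rparr>"

definition counital_comagma :: "('o, 'm) bimonoid_data \<Rightarrow> bool" where
  "counital_comagma D \<longleftrightarrow>
     obj D \<in> Obj C \<and>
     \<epsilon>\<^bsub>D\<^esub> \<in> hom C (obj D) \<K> \<and>
     \<delta>\<^bsub>D\<^esub> \<in> hom C (obj D) (obj D \<otimes>\<^sub>o obj D) \<and>
     (\<epsilon>\<^bsub>D\<^esub> \<otimes> \<one> (obj D)) \<cdot> \<delta>\<^bsub>D\<^esub> = \<one> (obj D) \<and>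
     (\<one> (obj D) \<otimes> \<epsilon>\<^bsub>D\<^esub>) \<cdot> \<delta>\<^bsub>D\<^esub> = \<one> (obj D)"

definition noncoassoc_bimonoid :: "('o, 'm) bimonoid_data \<Rightarrow> bool" where
  "noncoassoc_bimonoid H \<longleftrightarrow>
     monoid_in H \<and> counital_comagma H \<and>
     \<epsilon>\<^bsub>H\<^esub> \<cdot> \<eta>\<^bsub>H\<^esub> = \<one> \<K> \<and>
     \<delta>\<^bsub>H\<^esub> \<cdot> \<eta>\<^bsub>H\<^esub> = \<eta>\<^bsub>H\<^esub> \<otimes> \<eta>\<^bsub>H\<^esub> \<and>
     \<epsilon>\<^bsub>H\<^esub> \<cdot> \<mu>\<^bsub>H\<^esub> = \<epsilon>\<^bsub>H\<^esub> \<otimes> \<epsilon>\<^bsub>H\<^esub> \<and>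
     \<delta>\<^bsub>H\<^esub> \<cdot> \<mu>\<^bsub>H\<^esub> = \<mu>\<^bsub>tensor_monoid H H\<^esub> \<cdot> (\<delta>\<^bsub>H\<^esub> \<otimes> \<delta>\<^bsub>H\<^esub>)"

definition left_antipode :: "('o, 'm) bimonoid_data \<Rightarrow> 'm \<Rightarrow> bool" where
  "left_antipode H l \<longleftrightarrow>
     l \<in> hom C (obj H) (obj H) \<and>
     (\<mu>\<^bsub>H\<^esub> \<otimes> \<one> (obj H)) \<cdot> (l \<otimes> \<delta>\<^bsub>H\<^esub>) \<cdot> \<delta>\<^bsub>H\<^esub> = \<eta>\<^bsub>H\<^esub> \<otimes> \<one> (obj H) \<and>
     (\<mu>\<^bsub>H\<^esub> \<otimes> \<one> (obj H)) \<cdot> (\<one> (obj H) \<otimes> ((l \<otimes> \<one> (obj H)) \<cdot> \<delta>\<^bsub>H\<^esub>)) \<cdot> \<delta>\<^bsub>H\<^esub> = \<eta>\<^bsub>H\<^esub> \<otimes> \<one> (obj H)"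

definition left_Hopf_coquasigroup :: "('o, 'm) bimonoid_data \<Rightarrow> bool" where
  "left_Hopf_coquasigroup H \<longleftrightarrow> noncoassoc_bimonoid H \<and> (\<exists>l. left_antipode H l)"


section \<open>Convolution and twists\<close>

definition conv :: "('o, 'm, 'x) monoid_data_scheme \<Rightarrow> 'm \<Rightarrow> 'm \<Rightarrow> 'm" where
  "conv A f g = \<mu>\<^bsub>A\<^esub> \<cdot> (f \<otimes> g)"

definition conv_inverse_of :: "('o, 'm, 'x) monoid_data_scheme \<Rightarrow> 'm \<Rightarrow> 'm \<Rightarrow> bool" where
  "conv_inverse_of A f g \<longleftrightarrow>
     f \<in> hom C \<K> (obj A) \<and> g \<in> hom C \<K> (obj A) \<and>
     conv A f g = \<eta>\<^bsub>A\<^esub> \<and> conv A g f = \<eta>\<^bsub>A\<^esub>"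

text \<open>For a monoid \<open>A\<close> the inverse is unique; see \<open>conv_inv_eq\<close> below.\<close>

definition conv_inv :: "('o, 'm, 'x) monoid_data_scheme \<Rightarrow> 'm \<Rightarrow> 'm" where
  "conv_inv A f = (THE g. conv_inverse_of A f g)"

definition twist :: "('o, 'm) bimonoid_data \<Rightarrow> 'm \<Rightarrow> bool" where
  "twist H J \<longleftrightarrow>
     J \<in> hom C \<K> (obj H \<otimes>\<^sub>o obj H) \<and>
     (\<exists>J'. conv_inverse_of (tensor_monoid H H) J J') \<and>
     conv (tensor_monoid (tensor_monoid H H) H)
       ((\<delta>\<^bsub>H\<^esub> \<otimes> \<one> (obj H)) \<cdot> J) (J \<otimes> \<eta>\<^bsub>H\<^esub>) =
     conv (tensor_monoid (tensor_monoid H H) H)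
       ((\<one> (obj H) \<otimes> \<delta>\<^bsub>H\<^esub>) \<cdot> J) (\<eta>\<^bsub>H\<^esub> \<otimes> J)"

definition conormal :: "('o, 'm) bimonoid_data \<Rightarrow> 'm \<Rightarrow> bool" where
  "conormal H J \<longleftrightarrow>
     (\<epsilon>\<^bsub>H\<^esub> \<otimes> \<one> (obj H)) \<cdot> J = \<eta>\<^bsub>H\<^esub> \<and> (\<one> (obj H) \<otimes> \<epsilon>\<^bsub>H\<^esub>) \<cdot> J = \<eta>\<^bsub>H\<^esub>"

definition twist_inv :: "('o, 'm) bimonoid_data \<Rightarrow> 'm \<Rightarrow> 'm" where
  "twist_inv H J = conv_inv (tensor_monoid H H) J"

definition twist_deformation :: "('o, 'm) bimonoid_data \<Rightarrow> 'm \<Rightarrow> ('o, 'm) bimonoid_data" where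
  "twist_deformation H J = H\<lparr>delta :=
     \<mu>\<^bsub>tensor_monoid H H\<^esub>
       \<cdot> (\<mu>\<^bsub>tensor_monoid H H\<^esub> \<otimes> \<one> (obj H) \<otimes> \<one> (obj H))
       \<cdot> (twist_inv H J \<otimes> \<delta>\<^bsub>H\<^esub> \<otimes> J)\<rparr>"

end

lemma (in strict_monoidal_category) conv_inv_eq:
  assumes A: "monoid_in C A" and g: "conv_inverse_of C A f g"
  shows "conv_inv C A f = g"
  unfolding conv_inv_def
proof (rule the_equality)
  show "conv_inverse_of C A f g" by (rule g)
next
  fix h assume h: "conv_inverse_of C A f h"
  let ?A = "obj A" and ?I = "\<one> (obj A)"
  have fh: "f \<in> hom C \<K> ?A" "h \<in> hom C \<K> ?A" "g \<in> hom C \<K> ?A"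
    and hf: "\<mu>\<^bsub>A\<^esub> \<cdot> (h \<otimes> f) = \<eta>\<^bsub>A\<^esub>" and fg: "\<mu>\<^bsub>A\<^esub> \<cdot> (f \<otimes> g) = \<eta>\<^bsub>A\<^esub>"
    using g h by (auto simp: conv_inverse_of_def conv_def)
  have A': "?A \<in> Obj C" "\<eta>\<^bsub>A\<^esub> \<in> hom C \<K> ?A" "\<mu>\<^bsub>A\<^esub> \<in> hom C (?A \<otimes>\<^sub>o ?A) ?A"
    and ul: "\<mu>\<^bsub>A\<^esub> \<cdot> (\<eta>\<^bsub>A\<^esub> \<otimes> ?I) = ?I" and ur: "\<mu>\<^bsub>A\<^esub> \<cdot> (?I \<otimes> \<eta>\<^bsub>A\<^esub>) = ?I"
    and as: "\<mu>\<^bsub>A\<^esub> \<cdot> (\<mu>\<^bsub>A\<^esub> \<otimes> ?I) = \<mu>\<^bsub>A\<^esub> \<cdot> (?I \<otimes> \<mu>\<^bsub>A\<^esub>)"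
    using A by (auto simp: monoid_in_def)
  have arr: "x \<in> Arr C" if "x \<in> hom C X Y" for x X Y
    using that by (simp add: hom_def)
  note I = Id_hom[OF A'(1)] and K = Id_hom[OF unit_Obj]
  have KK: "\<K> \<otimes>\<^sub>o \<K> = \<K>" "\<K> \<otimes>\<^sub>o ?A = ?A" "?A \<otimes>\<^sub>o \<K> = ?A"
    using unit_obj_left unit_obj_right unit_Obj A'(1) by auto
  have hf': "h \<otimes> f \<in> hom C \<K> (?A \<otimes>\<^sub>o ?A)" and fg': "f \<otimes> g \<in> hom C \<K> (?A \<otimes>\<^sub>o ?A)"
    using tensor_hom[OF fh(2,1)] tensor_hom[OF fh(1,3)] KK by auto
  have eta_l: "\<mu>\<^bsub>A\<^esub> \<cdot> (\<eta>\<^bsub>A\<^esub> \<otimes> g) = g"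
  proof -
    have "\<eta>\<^bsub>A\<^esub> \<otimes> g = (\<eta>\<^bsub>A\<^esub> \<otimes> ?I) \<cdot> g"
      using interchange[OF K A'(2) fh(3) I]
      by (simp add: comp_Id_right[OF A'(2)] comp_Id_left[OF fh(3)] unit_arr_left[OF arr[OF fh(3)]])
    then show ?thesis
      using comp_assoc[OF fh(3) tensor_hom[OF A'(2) I, unfolded KK] A'(3)] ul
      by (simp add: comp_Id_left[OF fh(3)])
  qed
  have eta_r: "\<mu>\<^bsub>A\<^esub> \<cdot> (h \<otimes> \<eta>\<^bsub>A\<^esub>) = h"
  proof -
    have "h \<otimes> \<eta>\<^bsub>A\<^esub> = (?I \<otimes> \<eta>\<^bsub>A\<^esub>) \<cdot> h"
      using interchange[OF fh(2) I K A'(2)]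
      by (simp add: comp_Id_right[OF A'(2)] comp_Id_left[OF fh(2)] unit_arr_right[OF arr[OF fh(2)]])
    then show ?thesis
      using comp_assoc[OF fh(2) tensor_hom[OF I A'(2), unfolded KK] A'(3)] ur
      by (simp add: comp_Id_left[OF fh(2)])
  qed
  have hfg: "h \<otimes> f \<otimes> g \<in> hom C \<K> (?A \<otimes>\<^sub>o ?A \<otimes>\<^sub>o ?A)"
    using tensor_hom[OF fh(2) fg'] KK by simp
  have "g = \<mu>\<^bsub>A\<^esub> \<cdot> ((\<mu>\<^bsub>A\<^esub> \<cdot> (h \<otimes> f)) \<otimes> (?I \<cdot> g))"
    by (simp add: hf eta_l comp_Id_left[OF fh(3)])
  also have "\<dots> = \<mu>\<^bsub>A\<^esub> \<cdot> ((\<mu>\<^bsub>A\<^esub> \<otimes> ?I) \<cdot> (h \<otimes> f \<otimes> g))"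
    using interchange[OF hf' A'(3) fh(3) I] tensor_arr_assoc[OF arr arr arr, OF fh(2,1,3)] by simp
  also have "\<dots> = \<mu>\<^bsub>A\<^esub> \<cdot> ((?I \<otimes> \<mu>\<^bsub>A\<^esub>) \<cdot> (h \<otimes> f \<otimes> g))"
    using comp_assoc[OF hfg _ A'(3)] tensor_hom[OF A'(3) I] tensor_hom[OF I A'(3)] as
    by (metis tensor_obj_assoc A'(1))
  also have "\<dots> = \<mu>\<^bsub>A\<^esub> \<cdot> (h \<otimes> \<eta>\<^bsub>A\<^esub>)"
    using interchange[OF fh(2) I fg' A'(3)] fg by (simp add: comp_Id_left[OF fh(2)])
  finally show "h = g" by (simp add: eta_r)
qed

end

theory Submission
  imports Defs
begin

text \<open>
  In Sweedler notation, let \<open>T(a \<otimes> h) = a h\<^sub>1 \<otimes> h\<^sub>2\<close> and \<open>S(a \<otimes> h) = a \<lambda>(h\<^sub>1) \<otimes> h\<^sub>2\<close>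
  on \<open>H \<otimes> H\<close>. Both maps are left \<open>H\<close>-linear, and the two antipode equations say that they are
  inverse to each other (\<open>T_S\<close>, \<open>S_T\<close>). For the deformed coproduct
  \<open>\<delta>\<^sub>J(h) = J\<inverse> \<delta>(h) J\<close> the same two maps are \<open>T\<^sub>J(a \<otimes> h) = (a \<otimes> 1) \<delta>\<^sub>J(h)\<close> and
  \<open>S\<^sub>J(a \<otimes> h) = (a \<otimes> 1) (\<lambda>\<^sub>J \<otimes> 1)(\<delta>\<^sub>J(h))\<close>, and the task is to relate them to \<open>T\<close> and \<open>S\<close>.

  The relation uses two products on \<open>H \<otimes> H\<close>: the usual one, written \<open>\<bullet>\<close>, and the product \<open>\<odot>\<close> of
  \<open>H\<^sup>o\<^sup>p \<otimes> H\<close>. Put \<open>\<tau>(h) = \<lambda>(h\<^sub>1) \<otimes> h\<^sub>2\<close>. The map \<open>T\<close> intertwines the two: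
  \<open>T(x \<odot> (1 \<otimes> h)) = T(x) \<bullet> \<delta>(h)\<close> (\<open>T_right\<close>) and \<open>T(\<tau>(h) \<odot> x) = (1 \<otimes> h) \<bullet> T(x)\<close> (\<open>T_left\<close>).
  Since \<open>T\<close> is injective, the second formula makes \<open>\<tau>\<close> multiplicative for \<open>\<odot>\<close>, and the counit turns
  this into the antimultiplicativity of \<open>\<lambda>\<close> (\<open>hom_antipode\<close>).

  Write \<open>F = J\<inverse>\<close>, \<open>w = \<lambda>(J\<^sub>1) J\<^sub>2\<close>, and
  \<open>W = v \<lambda>(J\<^sub>1) \<otimes> J\<^sub>2\<close>, \<open>U = \<lambda>(F\<^sub>1) w \<otimes> F\<^sub>2\<close>. Contracting the twist equation in
  \<open>H \<otimes> H \<otimes> H\<close> along \<open>x \<otimes> y \<otimes> z \<mapsto> x \<lambda>(y) \<otimes> z\<close> and \<open>x \<otimes> y \<otimes> z \<mapsto> \<lambda>(x) y \<otimes> z\<close> gives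
  \<open>S(F) = W\<close> and \<open>T(\<lambda>(J\<^sub>1) \<otimes> J\<^sub>2) = (w \<otimes> 1) F\<close> (\<open>S_F\<close>, \<open>T_J_hat\<close>). These two equations and the
  counit show that \<open>v\<close> and \<open>w\<close> are inverse to each other, so \<open>U\<close> and \<open>W\<close> are inverse for \<open>\<odot>\<close>.
  As \<open>(\<lambda>\<^sub>J \<otimes> 1)(\<delta>\<^sub>J(h)) = U \<odot> \<tau>(h) \<odot> W\<close>, one finds
  \<open>T\<^sub>J(x) = T(W \<odot> x) \<bullet> J\<close> and \<open>S\<^sub>J(x) = U \<odot> S(x \<bullet> F)\<close> (\<open>T_deformed\<close>, \<open>S_deformed\<close>), and these are
  visibly inverse to each other.

  Elements are replaced by generalized elements, that is, arrows \<open>f : X \<rightarrow> A\<close> into a monoid \<open>A\<close>. The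
  convolution of \<open>f : X \<rightarrow> A\<close> and \<open>g : Y \<rightarrow> A\<close> is an arrow from \<open>X \<otimes> Y\<close>, and this product is strictly
  associative and unital for all domains. The symmetry enters only when two arguments change places,
  and it vanishes when one of them is a point, with domain the unit object. All the elements built
  from \<open>J\<close> are points, so the calculation above can be followed line by line.
\<close>

section \<open>Arrows of a strict symmetric monoidal category\<close>

context strict_symmetric_monoidal_category
begin

text \<open>
  Typing by \<open>Dom\<close> and \<open>Cod\<close> rather than by \<open>hom\<close> lets the simplifier compute the type of a
  composite and normalize it modulo strict associativity and units.
\<close>

lemma hom_iff: "f \<in> hom C X Y \<longleftrightarrow> f \<in> Arr C \<and> Dom C f = X \<and> Cod C f = Y"
  by (auto simp: hom_def)

lemma comp_arr [simp]:
  assumes "f \<in> Arr C" "g \<in> Arr C" "Dom C g = Cod C f"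
  shows "g \<cdot> f \<in> Arr C" "Dom C (g \<cdot> f) = Dom C f" "Cod C (g \<cdot> f) = Cod C g"
  using comp_hom[of f "Dom C f" "Cod C f" g "Cod C g"] assms by (auto simp: hom_iff)

lemma tensor_arr [simp]:
  assumes "f \<in> Arr C" "g \<in> Arr C"
  shows "f \<otimes> g \<in> Arr C" "Dom C (f \<otimes> g) = Dom C f \<otimes>\<^sub>o Dom C g"
    "Cod C (f \<otimes> g) = Cod C f \<otimes>\<^sub>o Cod C g"
  using tensor_hom[of f "Dom C f" "Cod C f" g "Dom C g" "Cod C g"] assms by (auto simp: hom_iff)

lemma Id_arr [simp]:
  assumes "A \<in> Obj C"
  shows "\<one> A \<in> Arr C" "Dom C (\<one> A) = A" "Cod C (\<one> A) = A"
  using Id_hom[OF assms] by (auto simp: hom_iff)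

lemma sym_is_arr [simp]:
  assumes "A \<in> Obj C" "B \<in> Obj C"
  shows "sym_arr C A B \<in> Arr C" "Dom C (sym_arr C A B) = A \<otimes>\<^sub>o B" "Cod C (sym_arr C A B) = B \<otimes>\<^sub>o A"
  using sym_hom[OF assms] by (auto simp: hom_iff)

lemmas [simp] = Dom_Obj Cod_Obj unit_Obj tensor_Obj tensor_obj_assoc unit_obj_left unit_obj_right
  tensor_arr_assoc unit_arr_left unit_arr_right tensor_Id

lemma comp_Id [simp]:
  assumes "f \<in> Arr C"
  shows "Cod C f = A \<Longrightarrow> \<one> A \<cdot> f = f" "Dom C f = A \<Longrightarrow> f \<cdot> \<one> A = f"
  using comp_Id_left[of f "Dom C f" A] comp_Id_right[of f A "Cod C f"] assms by (auto simp: hom_iff)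

lemma comp_reassoc [simp]:
  assumes "f \<in> Arr C" "g \<in> Arr C" "h \<in> Arr C" "Dom C g = Cod C f" "Dom C h = Cod C g"
  shows "(h \<cdot> g) \<cdot> f = h \<cdot> g \<cdot> f"
  using comp_assoc[of f "Dom C f" "Cod C f" g "Cod C g" h "Cod C h"] assms by (auto simp: hom_iff)

lemma tensor_Id_Id [simp]:
  assumes "A \<in> Obj C" "B \<in> Obj C" "f \<in> Arr C"
  shows "\<one> A \<otimes> \<one> B \<otimes> f = \<one> (A \<otimes>\<^sub>o B) \<otimes> f"
  using tensor_arr_assoc[of "\<one> A" "\<one> B" f] assms by simp

lemma tensor_comp:
  assumes "f \<in> Arr C" "g \<in> Arr C" "f' \<in> Arr C" "g' \<in> Arr C" "Dom C g = Cod C f" "Dom C g' = Cod C f'"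
  shows "(g \<otimes> g') \<cdot> (f \<otimes> f') = (g \<cdot> f) \<otimes> (g' \<cdot> f')"
  using interchange[of f "Dom C f" "Cod C f" g "Cod C g" f' "Dom C f'" "Cod C f'" g' "Cod C g'"] assms
  by (auto simp: hom_iff)

lemma tensor_comp_assoc:
  assumes "f \<in> Arr C" "g \<in> Arr C" "f' \<in> Arr C" "g' \<in> Arr C" "Dom C g = Cod C f" "Dom C g' = Cod C f'"
    "h \<in> Arr C" "Cod C h = Dom C f \<otimes>\<^sub>o Dom C f'"
  shows "(g \<otimes> g') \<cdot> (f \<otimes> f') \<cdot> h = ((g \<cdot> f) \<otimes> (g' \<cdot> f')) \<cdot> h"
  using assms by (simp flip: tensor_comp)

lemma sym_nat:
  assumes "f \<in> Arr C" "g \<in> Arr C"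
  shows "sym_arr C (Cod C f) (Cod C g) \<cdot> (f \<otimes> g) = (g \<otimes> f) \<cdot> sym_arr C (Dom C f) (Dom C g)"
  using sym_natural[of f "Dom C f" "Cod C f" g "Dom C g" "Cod C g"] assms by (auto simp: hom_iff)

text \<open>
  The hexagon with two unit objects makes the symmetry at the unit idempotent, and an invertible
  idempotent is an identity.
\<close>

lemma sym_unit_right [simp]:
  assumes A: "A \<in> Obj C"
  shows "sym_arr C A \<K> = \<one> A"
proof -
  let ?c = "sym_arr C A \<K>" and ?d = "sym_arr C \<K> A"
  have idem: "?c \<cdot> ?c = ?c" using hexagon[OF A unit_Obj unit_Obj] A by simp
  have inv: "?d \<cdot> ?c = \<one> A" using sym_sym[OF A unit_Obj] A by simp
  \<comment> \<open>cancel one factor of the idempotent with the inverse symmetry\<close>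
  have "?c = (?d \<cdot> ?c) \<cdot> ?c" using A inv by simp
  also have "\<dots> = ?d \<cdot> ?c \<cdot> ?c" by (rule comp_reassoc) (use A in auto)
  finally show ?thesis by (simp only: idem inv)
qed

lemma sym_unit_left [simp]:
  assumes A: "A \<in> Obj C"
  shows "sym_arr C \<K> A = \<one> A"
  using sym_sym[OF unit_Obj A] A by simp

lemma sym_tensor_right:
  assumes "A \<in> Obj C" "B \<in> Obj C" "D \<in> Obj C"
  shows "sym_arr C A (B \<otimes>\<^sub>o D) = (\<one> B \<otimes> sym_arr C A D) \<cdot> (sym_arr C A B \<otimes> \<one> D)"
  by (rule hexagon[OF assms])

text \<open>
  Both sides have the same left inverse, by the hexagon for the reversed symmetries.
\<close>

lemma sym_tensor_left:
  assumes [simp]: "A \<in> Obj C" "B \<in> Obj C" "D \<in> Obj C"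
  shows "sym_arr C (A \<otimes>\<^sub>o B) D = (sym_arr C A D \<otimes> \<one> B) \<cdot> (\<one> A \<otimes> sym_arr C B D)"
proof -
  let ?x = "(sym_arr C A D \<otimes> \<one> B) \<cdot> (\<one> A \<otimes> sym_arr C B D)"
  let ?y = "(\<one> A \<otimes> sym_arr C D B) \<cdot> (sym_arr C D A \<otimes> \<one> B)"
  have ss: "sym_arr C X Y \<cdot> sym_arr C Y X = \<one> (Y \<otimes>\<^sub>o X)" if "X \<in> Obj C" "Y \<in> Obj C" for X Y
    using sym_sym that by blast
  have yx: "?y \<cdot> ?x = \<one> (A \<otimes>\<^sub>o B \<otimes>\<^sub>o D)"
    by (simp add: tensor_comp tensor_comp_assoc ss)
  have "sym_arr C (A \<otimes>\<^sub>o B) D = sym_arr C (A \<otimes>\<^sub>o B) D \<cdot> ?y \<cdot> ?x"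
    unfolding yx by simp
  also have "\<dots> = (sym_arr C (A \<otimes>\<^sub>o B) D \<cdot> sym_arr C D (A \<otimes>\<^sub>o B)) \<cdot> ?x"
    unfolding sym_tensor_right[of D A B, simplified] by simp
  also have "\<dots> = ?x" by (simp add: ss)
  finally show ?thesis .
qed

section \<open>Convolution of generalized elements\<close>

text \<open>
  The convolution is used for arrows with arbitrary domains; see \<open>conv_assoc\<close> and \<open>conv_unit\<close>
  below. It is thus a product of generalized elements, graded by their domains.
\<close>

abbreviation conv_notation ("_ \<star>\<^bsub>_\<^esub> _" [61, 0, 60] 60) where
  "f \<star>\<^bsub>A\<^esub> g \<equiv> conv C A f g"

lemma monoid_arr [simp]:
  assumes "monoid_in C A"
  shows "obj A \<in> Obj C" "\<eta>\<^bsub>A\<^esub> \<in> Arr C" "Dom C \<eta>\<^bsub>A\<^esub> = \<K>" "Cod C \<eta>\<^bsub>A\<^esub> = obj A"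
    "\<mu>\<^bsub>A\<^esub> \<in> Arr C" "Dom C \<mu>\<^bsub>A\<^esub> = obj A \<otimes>\<^sub>o obj A" "Cod C \<mu>\<^bsub>A\<^esub> = obj A"
  using assms by (auto simp: monoid_in_def hom_iff)

lemma conv_arr [simp]:
  assumes "monoid_in C A" "f \<in> Arr C" "g \<in> Arr C" "Cod C f = obj A" "Cod C g = obj A"
  shows "f \<star>\<^bsub>A\<^esub> g \<in> Arr C" "Dom C (f \<star>\<^bsub>A\<^esub> g) = Dom C f \<otimes>\<^sub>o Dom C g" "Cod C (f \<star>\<^bsub>A\<^esub> g) = obj A"
  using assms by (auto simp: conv_def)

lemma conv_comp:
  assumes "monoid_in C A" "f \<in> Arr C" "g \<in> Arr C" "Cod C f = obj A" "Cod C g = obj A"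
    and "x \<in> Arr C" "y \<in> Arr C" "Cod C x = Dom C f" "Cod C y = Dom C g"
  shows "(f \<star>\<^bsub>A\<^esub> g) \<cdot> (x \<otimes> y) = (f \<cdot> x) \<star>\<^bsub>A\<^esub> (g \<cdot> y)"
  using assms by (simp add: conv_def tensor_comp)

lemma conv_unit [simp]:
  assumes A: "monoid_in C A" and f: "f \<in> Arr C" "Cod C f = obj A"
  shows "\<eta>\<^bsub>A\<^esub> \<star>\<^bsub>A\<^esub> f = f" "f \<star>\<^bsub>A\<^esub> \<eta>\<^bsub>A\<^esub> = f"
proof -
  have u: "\<mu>\<^bsub>A\<^esub> \<cdot> (\<eta>\<^bsub>A\<^esub> \<otimes> \<one> (obj A)) = \<one> (obj A)" "\<mu>\<^bsub>A\<^esub> \<cdot> (\<one> (obj A) \<otimes> \<eta>\<^bsub>A\<^esub>) = \<one> (obj A)"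
    using A by (auto simp: monoid_in_def)
  have "\<eta>\<^bsub>A\<^esub> \<otimes> f = (\<eta>\<^bsub>A\<^esub> \<otimes> \<one> (obj A)) \<cdot> f"
    using A f tensor_comp[of "\<one> \<K>" "\<eta>\<^bsub>A\<^esub>" f "\<one> (obj A)"] by simp
  then have "\<eta>\<^bsub>A\<^esub> \<star>\<^bsub>A\<^esub> f = (\<mu>\<^bsub>A\<^esub> \<cdot> (\<eta>\<^bsub>A\<^esub> \<otimes> \<one> (obj A))) \<cdot> f"
    using A f by (simp add: conv_def)
  then show "\<eta>\<^bsub>A\<^esub> \<star>\<^bsub>A\<^esub> f = f" using f by (simp add: u)
  have "f \<otimes> \<eta>\<^bsub>A\<^esub> = (\<one> (obj A) \<otimes> \<eta>\<^bsub>A\<^esub>) \<cdot> f"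
    using A f tensor_comp[of f "\<one> (obj A)" "\<one> \<K>" "\<eta>\<^bsub>A\<^esub>"] by simp
  then have "f \<star>\<^bsub>A\<^esub> \<eta>\<^bsub>A\<^esub> = (\<mu>\<^bsub>A\<^esub> \<cdot> (\<one> (obj A) \<otimes> \<eta>\<^bsub>A\<^esub>)) \<cdot> f"
    using A f by (simp add: conv_def)
  then show "f \<star>\<^bsub>A\<^esub> \<eta>\<^bsub>A\<^esub> = f" using f by (simp add: u)
qed

lemma conv_assoc:
  assumes A: "monoid_in C A" and "f \<in> Arr C" "g \<in> Arr C" "h \<in> Arr C"
    and "Cod C f = obj A" "Cod C g = obj A" "Cod C h = obj A"
  shows "(f \<star>\<^bsub>A\<^esub> g) \<star>\<^bsub>A\<^esub> h = f \<star>\<^bsub>A\<^esub> (g \<star>\<^bsub>A\<^esub> h)"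
proof -
  have as: "\<mu>\<^bsub>A\<^esub> \<cdot> (\<mu>\<^bsub>A\<^esub> \<otimes> \<one> (obj A)) = \<mu>\<^bsub>A\<^esub> \<cdot> (\<one> (obj A) \<otimes> \<mu>\<^bsub>A\<^esub>)"
    using A by (auto simp: monoid_in_def)
  have "(f \<star>\<^bsub>A\<^esub> g) \<star>\<^bsub>A\<^esub> h = \<mu>\<^bsub>A\<^esub> \<cdot> (\<mu>\<^bsub>A\<^esub> \<otimes> \<one> (obj A)) \<cdot> ((f \<otimes> g) \<otimes> h)"
    unfolding conv_def using assms by (subst tensor_comp) (auto simp del: tensor_arr_assoc)
  also have "\<dots> = (\<mu>\<^bsub>A\<^esub> \<cdot> (\<mu>\<^bsub>A\<^esub> \<otimes> \<one> (obj A))) \<cdot> (f \<otimes> g \<otimes> h)"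
    using assms by simp
  also have "\<dots> = f \<star>\<^bsub>A\<^esub> (g \<star>\<^bsub>A\<^esub> h)"
    unfolding as conv_def using assms by (simp add: tensor_comp)
  finally show ?thesis .
qed

lemma monoid_inI:
  assumes [simp]: "obj A \<in> Obj C" "\<eta>\<^bsub>A\<^esub> \<in> Arr C" "Dom C \<eta>\<^bsub>A\<^esub> = \<K>" "Cod C \<eta>\<^bsub>A\<^esub> = obj A"
    "\<mu>\<^bsub>A\<^esub> \<in> Arr C" "Dom C \<mu>\<^bsub>A\<^esub> = obj A \<otimes>\<^sub>o obj A" "Cod C \<mu>\<^bsub>A\<^esub> = obj A"
    and "\<mu>\<^bsub>A\<^esub> \<cdot> (\<eta>\<^bsub>A\<^esub> \<otimes> \<one> (obj A)) = \<one> (obj A)"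
    "\<mu>\<^bsub>A\<^esub> \<cdot> (\<one> (obj A) \<otimes> \<eta>\<^bsub>A\<^esub>) = \<one> (obj A)"
    "\<mu>\<^bsub>A\<^esub> \<cdot> (\<mu>\<^bsub>A\<^esub> \<otimes> \<one> (obj A)) = \<mu>\<^bsub>A\<^esub> \<cdot> (\<one> (obj A) \<otimes> \<mu>\<^bsub>A\<^esub>)"
  shows "monoid_in C A"
  using assms by (simp add: monoid_in_def hom_iff)

section \<open>Tensor products of monoids\<close>

lemma tensor_monoid_simps [simp]:
  "obj (tensor_monoid C A B) = obj A \<otimes>\<^sub>o obj B"
  "\<eta>\<^bsub>tensor_monoid C A B\<^esub> = \<eta>\<^bsub>A\<^esub> \<otimes> \<eta>\<^bsub>B\<^esub>"
  by (simp_all add: tensor_monoid_def)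

text \<open>
  The products of the two components are taken separately once the inner domains have changed
  places. If one of these is the unit object, no symmetry remains (\<open>conv_tensor_point_middle\<close>).
\<close>

lemma conv_tensor:
  assumes A: "monoid_in C A" and B: "monoid_in C B"
    and [simp]: "f \<in> Arr C" "g \<in> Arr C" "f' \<in> Arr C" "g' \<in> Arr C"
      "Cod C f = obj A" "Cod C f' = obj A" "Cod C g = obj B" "Cod C g' = obj B"
  shows "(f \<otimes> g) \<star>\<^bsub>tensor_monoid C A B\<^esub> (f' \<otimes> g') =
    ((f \<star>\<^bsub>A\<^esub> f') \<otimes> (g \<star>\<^bsub>B\<^esub> g')) \<cdot> (\<one> (Dom C f) \<otimes> sym_arr C (Dom C g) (Dom C f') \<otimes> \<one> (Dom C g'))"
proof -
  note [simp] = A B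
  \<comment> \<open>naturality of the symmetry in the two inner factors\<close>
  have "(\<one> (obj A) \<otimes> sym_arr C (obj B) (obj A) \<otimes> \<one> (obj B)) \<cdot> (f \<otimes> (g \<otimes> f') \<otimes> g')
    = f \<otimes> ((sym_arr C (obj B) (obj A) \<cdot> (g \<otimes> f')) \<otimes> g')"
    by (simp add: tensor_comp del: tensor_arr_assoc)
  also have "\<dots> = f \<otimes> (((f' \<otimes> g) \<cdot> sym_arr C (Dom C g) (Dom C f')) \<otimes> g')"
    using sym_nat[of g f'] by simp
  also have "\<dots> = (f \<otimes> (f' \<otimes> g) \<otimes> g') \<cdot> (\<one> (Dom C f) \<otimes> sym_arr C (Dom C g) (Dom C f') \<otimes> \<one> (Dom C g'))"
    by (simp add: tensor_comp del: tensor_arr_assoc)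
  finally have 1: "(\<one> (obj A) \<otimes> sym_arr C (obj B) (obj A) \<otimes> \<one> (obj B)) \<cdot> (f \<otimes> g \<otimes> f' \<otimes> g')
    = (f \<otimes> f' \<otimes> g \<otimes> g') \<cdot> (\<one> (Dom C f) \<otimes> sym_arr C (Dom C g) (Dom C f') \<otimes> \<one> (Dom C g'))"
    by simp
  have 2: "(\<mu>\<^bsub>A\<^esub> \<otimes> \<mu>\<^bsub>B\<^esub>) \<cdot> (f \<otimes> f' \<otimes> g \<otimes> g') = (f \<star>\<^bsub>A\<^esub> f') \<otimes> (g \<star>\<^bsub>B\<^esub> g')"
    using tensor_comp[of "f \<otimes> f'" "\<mu>\<^bsub>A\<^esub>" "g \<otimes> g'" "\<mu>\<^bsub>B\<^esub>"] by (simp add: conv_def)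
  show ?thesis
    unfolding 2[symmetric]
    by (simp add: conv_def tensor_monoid_def 1)
qed

text \<open>
  Associativity: by \<open>conv_tensor\<close> and the associativity of the factors, both threefold products are a
  product of components after a permutation of \<open>A B A B A B\<close>. The hexagons write either
  permutation as three elementary symmetries, of which the two disjoint ones may be exchanged.
\<close>

lemma monoid_tensor [simp]:
  assumes A: "monoid_in C A" and B: "monoid_in C B"
  shows "monoid_in C (tensor_monoid C A B)"
proof (rule monoid_inI)
  note [simp] = A B
  let ?A = "obj A" and ?B = "obj B" and ?M = "tensor_monoid C A B"
  let ?c = "sym_arr C ?B ?A"
  let ?m = "\<mu>\<^bsub>?M\<^esub>"
  show "obj ?M \<in> Obj C" "\<eta>\<^bsub>?M\<^esub> \<in> Arr C" "Dom C \<eta>\<^bsub>?M\<^esub> = \<K>" "Cod C \<eta>\<^bsub>?M\<^esub> = obj ?M"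
    by simp_all
  show m [simp]: "?m \<in> Arr C" "Dom C ?m = obj ?M \<otimes>\<^sub>o obj ?M" "Cod C ?m = obj ?M"
    by (simp_all add: tensor_monoid_def)
  show "?m \<cdot> (\<eta>\<^bsub>?M\<^esub> \<otimes> \<one> (obj ?M)) = \<one> (obj ?M)"
    using conv_tensor[of A B "\<eta>\<^bsub>A\<^esub>" "\<eta>\<^bsub>B\<^esub>" "\<one> ?A" "\<one> ?B"] by (simp add: conv_def[of C ?M])
  show "?m \<cdot> (\<one> (obj ?M) \<otimes> \<eta>\<^bsub>?M\<^esub>) = \<one> (obj ?M)"
    using conv_tensor[of A B "\<one> ?A" "\<one> ?B" "\<eta>\<^bsub>A\<^esub>" "\<eta>\<^bsub>B\<^esub>"] by (simp add: conv_def[of C ?M])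
  have mm: "?m = (\<mu>\<^bsub>A\<^esub> \<otimes> \<mu>\<^bsub>B\<^esub>) \<cdot> (\<one> ?A \<otimes> ?c \<otimes> \<one> ?B)"
    by (simp add: tensor_monoid_def)
  let ?mA = "\<mu>\<^bsub>A\<^esub>" and ?mB = "\<mu>\<^bsub>B\<^esub>"
  have asA: "?mA \<star>\<^bsub>A\<^esub> \<one> ?A = \<one> ?A \<star>\<^bsub>A\<^esub> ?mA" and asB: "?mB \<star>\<^bsub>B\<^esub> \<one> ?B = \<one> ?B \<star>\<^bsub>B\<^esub> ?mB"
    using A B by (auto simp: monoid_in_def conv_def)
  have L: "?m \<cdot> (?m \<otimes> \<one> (?A \<otimes>\<^sub>o ?B)) =
     ((?mA \<star>\<^bsub>A\<^esub> \<one> ?A) \<otimes> (?mB \<star>\<^bsub>B\<^esub> \<one> ?B)) \<cdot>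
      (\<one> (?A \<otimes>\<^sub>o ?A) \<otimes> sym_arr C (?B \<otimes>\<^sub>o ?B) ?A \<otimes> \<one> ?B) \<cdot> (\<one> ?A \<otimes> ?c \<otimes> \<one> ?B \<otimes> \<one> ?A \<otimes> \<one> ?B)"
  proof -
    have "?m \<otimes> \<one> (?A \<otimes>\<^sub>o ?B) = (?mA \<otimes> ?mB \<otimes> \<one> ?A \<otimes> \<one> ?B) \<cdot> (\<one> ?A \<otimes> ?c \<otimes> \<one> ?B \<otimes> \<one> ?A \<otimes> \<one> ?B)"
      using tensor_comp[of "\<one> ?A \<otimes> ?c \<otimes> \<one> ?B" "?mA \<otimes> ?mB" "\<one> (?A \<otimes>\<^sub>o ?B)" "\<one> (?A \<otimes>\<^sub>o ?B)"]
      by (simp add: mm)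
    moreover have "?m \<cdot> (?mA \<otimes> ?mB \<otimes> \<one> ?A \<otimes> \<one> ?B) =
      ((?mA \<star>\<^bsub>A\<^esub> \<one> ?A) \<otimes> (?mB \<star>\<^bsub>B\<^esub> \<one> ?B)) \<cdot> (\<one> (?A \<otimes>\<^sub>o ?A) \<otimes> sym_arr C (?B \<otimes>\<^sub>o ?B) ?A \<otimes> \<one> ?B)"
      using conv_tensor[of A B ?mA ?mB "\<one> ?A" "\<one> ?B"] by (simp add: conv_def[of C ?M])
    ultimately show ?thesis
      using comp_reassoc[of "\<one> ?A \<otimes> ?c \<otimes> \<one> ?B \<otimes> \<one> ?A \<otimes> \<one> ?B" "?mA \<otimes> ?mB \<otimes> \<one> ?A \<otimes> \<one> ?B" ?m]
      by simp
  qed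
  have R: "?m \<cdot> (\<one> (?A \<otimes>\<^sub>o ?B) \<otimes> ?m) =
     ((\<one> ?A \<star>\<^bsub>A\<^esub> ?mA) \<otimes> (\<one> ?B \<star>\<^bsub>B\<^esub> ?mB)) \<cdot>
      (\<one> ?A \<otimes> sym_arr C ?B (?A \<otimes>\<^sub>o ?A) \<otimes> \<one> (?B \<otimes>\<^sub>o ?B)) \<cdot> (\<one> ?A \<otimes> \<one> ?B \<otimes> \<one> ?A \<otimes> ?c \<otimes> \<one> ?B)"
  proof -
    have "\<one> (?A \<otimes>\<^sub>o ?B) \<otimes> ?m = (\<one> ?A \<otimes> \<one> ?B \<otimes> ?mA \<otimes> ?mB) \<cdot> (\<one> ?A \<otimes> \<one> ?B \<otimes> \<one> ?A \<otimes> ?c \<otimes> \<one> ?B)"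
      using tensor_comp[of "\<one> (?A \<otimes>\<^sub>o ?B)" "\<one> (?A \<otimes>\<^sub>o ?B)" "\<one> ?A \<otimes> ?c \<otimes> \<one> ?B" "?mA \<otimes> ?mB"]
      by (simp add: mm)
    moreover have "?m \<cdot> (\<one> ?A \<otimes> \<one> ?B \<otimes> ?mA \<otimes> ?mB) =
      ((\<one> ?A \<star>\<^bsub>A\<^esub> ?mA) \<otimes> (\<one> ?B \<star>\<^bsub>B\<^esub> ?mB)) \<cdot> (\<one> ?A \<otimes> sym_arr C ?B (?A \<otimes>\<^sub>o ?A) \<otimes> \<one> (?B \<otimes>\<^sub>o ?B))"
      using conv_tensor[of A B "\<one> ?A" "\<one> ?B" ?mA ?mB] by (simp add: conv_def[of C ?M])
    ultimately show ?thesis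
      using comp_reassoc[of "\<one> ?A \<otimes> \<one> ?B \<otimes> \<one> ?A \<otimes> ?c \<otimes> \<one> ?B" "\<one> ?A \<otimes> \<one> ?B \<otimes> ?mA \<otimes> ?mB" ?m]
      by simp
  qed
  \<comment> \<open>the two permutations agree\<close>
  have "(\<one> (?A \<otimes>\<^sub>o ?A) \<otimes> sym_arr C (?B \<otimes>\<^sub>o ?B) ?A \<otimes> \<one> ?B) \<cdot> (\<one> ?A \<otimes> ?c \<otimes> \<one> ?B \<otimes> \<one> ?A \<otimes> \<one> ?B)
    = \<one> ?A \<otimes> ((\<one> ?A \<otimes> sym_arr C (?B \<otimes>\<^sub>o ?B) ?A) \<cdot> (?c \<otimes> \<one> (?B \<otimes>\<^sub>o ?A))) \<otimes> \<one> ?B"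
    using tensor_comp[of "\<one> ?A" "\<one> ?A" "(?c \<otimes> \<one> (?B \<otimes>\<^sub>o ?A)) \<otimes> \<one> ?B"
       "(\<one> ?A \<otimes> sym_arr C (?B \<otimes>\<^sub>o ?B) ?A) \<otimes> \<one> ?B"]
      tensor_comp[of "?c \<otimes> \<one> (?B \<otimes>\<^sub>o ?A)" "\<one> ?A \<otimes> sym_arr C (?B \<otimes>\<^sub>o ?B) ?A" "\<one> ?B" "\<one> ?B"]
    by simp
  also have "(\<one> ?A \<otimes> sym_arr C (?B \<otimes>\<^sub>o ?B) ?A) \<cdot> (?c \<otimes> \<one> (?B \<otimes>\<^sub>o ?A))
    = (\<one> ?A \<otimes> ?c \<otimes> \<one> ?B) \<cdot> (?c \<otimes> ?c)"
  proof -
    have "\<one> ?A \<otimes> sym_arr C (?B \<otimes>\<^sub>o ?B) ?A = (\<one> ?A \<otimes> ?c \<otimes> \<one> ?B) \<cdot> (\<one> (?A \<otimes>\<^sub>o ?B) \<otimes> ?c)"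
      using tensor_comp[of "\<one> ?A" "\<one> ?A" "\<one> ?B \<otimes> ?c" "?c \<otimes> \<one> ?B"] by (simp add: sym_tensor_left)
    then show ?thesis
      using tensor_comp[of ?c "\<one> (?A \<otimes>\<^sub>o ?B)" "\<one> (?B \<otimes>\<^sub>o ?A)" ?c] by simp
  qed
  also have "(\<one> ?A \<otimes> ?c \<otimes> \<one> ?B) \<cdot> (?c \<otimes> ?c)
    = (sym_arr C ?B (?A \<otimes>\<^sub>o ?A) \<otimes> \<one> ?B) \<cdot> (\<one> (?B \<otimes>\<^sub>o ?A) \<otimes> ?c)"
  proof -
    have "sym_arr C ?B (?A \<otimes>\<^sub>o ?A) \<otimes> \<one> ?B = (\<one> ?A \<otimes> ?c \<otimes> \<one> ?B) \<cdot> (?c \<otimes> \<one> (?A \<otimes>\<^sub>o ?B))"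
      using tensor_comp[of "?c \<otimes> \<one> ?A" "\<one> ?A \<otimes> ?c" "\<one> ?B" "\<one> ?B"] by (simp add: sym_tensor_right)
    then show ?thesis
      using tensor_comp[of "\<one> (?B \<otimes>\<^sub>o ?A)" ?c ?c "\<one> (?A \<otimes>\<^sub>o ?B)"] by simp
  qed
  also have "\<one> ?A \<otimes> ((sym_arr C ?B (?A \<otimes>\<^sub>o ?A) \<otimes> \<one> ?B) \<cdot> (\<one> (?B \<otimes>\<^sub>o ?A) \<otimes> ?c)) \<otimes> \<one> ?B
    = (\<one> ?A \<otimes> sym_arr C ?B (?A \<otimes>\<^sub>o ?A) \<otimes> \<one> (?B \<otimes>\<^sub>o ?B)) \<cdot> (\<one> ?A \<otimes> \<one> ?B \<otimes> \<one> ?A \<otimes> ?c \<otimes> \<one> ?B)"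
    using tensor_comp[of "\<one> ?A" "\<one> ?A" "(\<one> (?B \<otimes>\<^sub>o ?A) \<otimes> ?c) \<otimes> \<one> ?B"
       "(sym_arr C ?B (?A \<otimes>\<^sub>o ?A) \<otimes> \<one> ?B) \<otimes> \<one> ?B"]
      tensor_comp[of "\<one> (?B \<otimes>\<^sub>o ?A) \<otimes> ?c" "sym_arr C ?B (?A \<otimes>\<^sub>o ?A) \<otimes> \<one> ?B" "\<one> ?B" "\<one> ?B"]
    by simp
  finally show "?m \<cdot> (?m \<otimes> \<one> (obj ?M)) = ?m \<cdot> (\<one> (obj ?M) \<otimes> ?m)"
    using L R by (simp add: asA asB)
qed

lemma mu_eq_conv: "monoid_in C A \<Longrightarrow> \<one> (obj A) \<star>\<^bsub>A\<^esub> \<one> (obj A) = \<mu>\<^bsub>A\<^esub>"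
  by (simp add: conv_def)

lemma conv_tensor_point_middle:
  assumes A: "monoid_in C A" and B: "monoid_in C B"
    and "f \<in> Arr C" "g \<in> Arr C" "f' \<in> Arr C" "g' \<in> Arr C"
      "Cod C f = obj A" "Cod C f' = obj A" "Cod C g = obj B" "Cod C g' = obj B"
    and "Dom C g = \<K> \<or> Dom C f' = \<K>"
  shows "(f \<otimes> g) \<star>\<^bsub>tensor_monoid C A B\<^esub> (f' \<otimes> g') = (f \<star>\<^bsub>A\<^esub> f') \<otimes> (g \<star>\<^bsub>B\<^esub> g')"
  using assms by (auto simp: conv_tensor[OF A B])

text \<open>
  A product with a factor in the outer component uses only the multiplication of that component; in
  particular it is the same for any two structures on the other component.
\<close>

lemma conv_first_left:
  assumes A: "monoid_in C A" and B: "monoid_in C B"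
    and "a \<in> Arr C" "f \<in> Arr C" "Cod C a = obj A" "Cod C f = obj A \<otimes>\<^sub>o obj B"
  shows "(a \<otimes> \<eta>\<^bsub>B\<^esub>) \<star>\<^bsub>tensor_monoid C A B\<^esub> f = (\<mu>\<^bsub>A\<^esub> \<otimes> \<one> (obj B)) \<cdot> (a \<otimes> f)"
proof -
  let ?M = "tensor_monoid C A B"
  note [simp] = assms
  have "(a \<otimes> \<eta>\<^bsub>B\<^esub>) \<star>\<^bsub>?M\<^esub> (\<one> (obj A) \<otimes> \<one> (obj B)) = (\<mu>\<^bsub>A\<^esub> \<cdot> (a \<otimes> \<one> (obj A))) \<otimes> \<one> (obj B)"
    by (subst conv_tensor_point_middle) (simp_all, simp add: conv_def)
  also have "\<dots> = (\<mu>\<^bsub>A\<^esub> \<otimes> \<one> (obj B)) \<cdot> (a \<otimes> \<one> (obj A) \<otimes> \<one> (obj B))"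
    using tensor_comp[of "a \<otimes> \<one> (obj A)" "\<mu>\<^bsub>A\<^esub>" "\<one> (obj B)" "\<one> (obj B)"] by simp
  finally have 1: "(a \<otimes> \<eta>\<^bsub>B\<^esub>) \<star>\<^bsub>?M\<^esub> \<one> (obj ?M) = (\<mu>\<^bsub>A\<^esub> \<otimes> \<one> (obj B)) \<cdot> (a \<otimes> \<one> (obj ?M))"
    by simp
  have 2: "a \<otimes> f = (a \<otimes> \<one> (obj ?M)) \<cdot> (\<one> (Dom C a) \<otimes> f)"
    by (simp add: tensor_comp)
  have "(a \<otimes> \<eta>\<^bsub>B\<^esub>) \<star>\<^bsub>?M\<^esub> f = ((a \<otimes> \<eta>\<^bsub>B\<^esub>) \<star>\<^bsub>?M\<^esub> \<one> (obj ?M)) \<cdot> (\<one> (Dom C a) \<otimes> f)"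
    by (subst conv_comp) simp_all
  then show ?thesis unfolding 1 2 by simp
qed

lemma conv_second_right:
  assumes A: "monoid_in C A" and B: "monoid_in C B"
    and "b \<in> Arr C" "f \<in> Arr C" "Cod C b = obj B" "Cod C f = obj A \<otimes>\<^sub>o obj B"
  shows "f \<star>\<^bsub>tensor_monoid C A B\<^esub> (\<eta>\<^bsub>A\<^esub> \<otimes> b) = (\<one> (obj A) \<otimes> \<mu>\<^bsub>B\<^esub>) \<cdot> (f \<otimes> b)"
proof -
  let ?M = "tensor_monoid C A B"
  note [simp] = assms
  have "(\<one> (obj A) \<otimes> \<one> (obj B)) \<star>\<^bsub>?M\<^esub> (\<eta>\<^bsub>A\<^esub> \<otimes> b) = \<one> (obj A) \<otimes> (\<mu>\<^bsub>B\<^esub> \<cdot> (\<one> (obj B) \<otimes> b))"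
    by (subst conv_tensor_point_middle) (simp_all, simp add: conv_def)
  also have "\<dots> = (\<one> (obj A) \<otimes> \<mu>\<^bsub>B\<^esub>) \<cdot> (\<one> (obj A) \<otimes> \<one> (obj B) \<otimes> b)"
    using tensor_comp[of "\<one> (obj A)" "\<one> (obj A)" "\<one> (obj B) \<otimes> b" "\<mu>\<^bsub>B\<^esub>"] by simp
  finally have 1: "\<one> (obj ?M) \<star>\<^bsub>?M\<^esub> (\<eta>\<^bsub>A\<^esub> \<otimes> b) = (\<one> (obj A) \<otimes> \<mu>\<^bsub>B\<^esub>) \<cdot> (\<one> (obj ?M) \<otimes> b)"
    by simp
  have 2: "f \<otimes> b = (\<one> (obj ?M) \<otimes> b) \<cdot> (f \<otimes> \<one> (Dom C b))"
    by (simp add: tensor_comp)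
  have "f \<star>\<^bsub>?M\<^esub> (\<eta>\<^bsub>A\<^esub> \<otimes> b) = (\<one> (obj ?M) \<star>\<^bsub>?M\<^esub> (\<eta>\<^bsub>A\<^esub> \<otimes> b)) \<cdot> (f \<otimes> \<one> (Dom C b))"
    by (subst conv_comp) simp_all
  then show ?thesis unfolding 1 2 by simp
qed

lemma conv_second_left:
  assumes A: "monoid_in C A" and B: "monoid_in C B"
    and "b \<in> Arr C" "f \<in> Arr C" "g \<in> Arr C" "Cod C b = obj B" "Cod C f = obj A" "Cod C g = obj B"
  shows "(\<eta>\<^bsub>A\<^esub> \<otimes> b) \<star>\<^bsub>tensor_monoid C A B\<^esub> (f \<otimes> g) =
    (f \<otimes> (b \<star>\<^bsub>B\<^esub> g)) \<cdot> (sym_arr C (Dom C b) (Dom C f) \<otimes> \<one> (Dom C g))"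
  using assms by (simp add: conv_tensor)

section \<open>Opposite monoids and morphisms of monoids\<close>

definition op_monoid :: "('a, 'b, 'x) monoid_data_scheme \<Rightarrow> ('a, 'b) monoid_data" where
  "op_monoid A = \<lparr>obj = obj A, eta = \<eta>\<^bsub>A\<^esub>, mu = \<mu>\<^bsub>A\<^esub> \<cdot> sym_arr C (obj A) (obj A)\<rparr>"

lemma op_monoid_simps [simp]: "obj (op_monoid A) = obj A" "\<eta>\<^bsub>op_monoid A\<^esub> = \<eta>\<^bsub>A\<^esub>"
  by (simp_all add: op_monoid_def)

lemma conv_op:
  assumes "monoid_in C A" "f \<in> Arr C" "g \<in> Arr C" "Cod C f = obj A" "Cod C g = obj A"
  shows "f \<star>\<^bsub>op_monoid A\<^esub> g = (g \<star>\<^bsub>A\<^esub> f) \<cdot> sym_arr C (Dom C f) (Dom C g)"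
  using assms sym_nat[of f g] by (simp add: conv_def op_monoid_def)

lemma conv_op_point:
  assumes "monoid_in C A" "f \<in> Arr C" "g \<in> Arr C" "Cod C f = obj A" "Cod C g = obj A"
    and "Dom C f = \<K> \<or> Dom C g = \<K>"
  shows "f \<star>\<^bsub>op_monoid A\<^esub> g = g \<star>\<^bsub>A\<^esub> f"
  using assms by (auto simp: conv_op)

text \<open>
  Reversing three factors by either pair of symmetries gives the same permutation; this is the braid
  relation, which follows from naturality and the hexagons.
\<close>

lemma monoid_op [simp]:
  assumes A: "monoid_in C A"
  shows "monoid_in C (op_monoid A)"
proof (rule monoid_inI)
  note [simp] = A
  let ?O = "op_monoid A" and ?A = "obj A" and ?m = "\<mu>\<^bsub>A\<^esub>"
  let ?I = "\<one> (obj A)" and ?c = "sym_arr C (obj A) (obj A)"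
  show "\<mu>\<^bsub>?O\<^esub> \<in> Arr C" "Dom C \<mu>\<^bsub>?O\<^esub> = obj ?O \<otimes>\<^sub>o obj ?O" "Cod C \<mu>\<^bsub>?O\<^esub> = obj ?O"
    by (simp_all add: op_monoid_def)
  have u: "f \<star>\<^bsub>?O\<^esub> g = \<mu>\<^bsub>?O\<^esub> \<cdot> (f \<otimes> g)" for f g by (simp add: conv_def)
  show "\<mu>\<^bsub>?O\<^esub> \<cdot> (\<eta>\<^bsub>?O\<^esub> \<otimes> \<one> (obj ?O)) = \<one> (obj ?O)"
    "\<mu>\<^bsub>?O\<^esub> \<cdot> (\<one> (obj ?O) \<otimes> \<eta>\<^bsub>?O\<^esub>) = \<one> (obj ?O)"
    by (simp_all add: conv_op flip: u)
  have m: "\<mu>\<^bsub>?O\<^esub> = ?m \<cdot> ?c" by (simp add: op_monoid_def)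
  have L: "\<mu>\<^bsub>?O\<^esub> \<star>\<^bsub>?O\<^esub> ?I = (?I \<star>\<^bsub>A\<^esub> ?m) \<cdot> (?I \<otimes> ?c) \<cdot> sym_arr C (?A \<otimes>\<^sub>o ?A) ?A"
  proof -
    have "\<mu>\<^bsub>?O\<^esub> \<star>\<^bsub>?O\<^esub> ?I = (?I \<star>\<^bsub>A\<^esub> (?m \<cdot> ?c)) \<cdot> sym_arr C (?A \<otimes>\<^sub>o ?A) ?A"
      unfolding m by (subst conv_op) simp_all
    moreover have "?I \<star>\<^bsub>A\<^esub> (?m \<cdot> ?c) = (?I \<star>\<^bsub>A\<^esub> ?m) \<cdot> (?I \<otimes> ?c)"
      by (subst conv_comp) simp_all
    ultimately show ?thesis by simp
  qed
  have R: "?I \<star>\<^bsub>?O\<^esub> \<mu>\<^bsub>?O\<^esub> = (?m \<star>\<^bsub>A\<^esub> ?I) \<cdot> (?c \<otimes> ?I) \<cdot> sym_arr C ?A (?A \<otimes>\<^sub>o ?A)"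
  proof -
    have "?I \<star>\<^bsub>?O\<^esub> \<mu>\<^bsub>?O\<^esub> = ((?m \<cdot> ?c) \<star>\<^bsub>A\<^esub> ?I) \<cdot> sym_arr C ?A (?A \<otimes>\<^sub>o ?A)"
      unfolding m by (subst conv_op) simp_all
    moreover have "(?m \<cdot> ?c) \<star>\<^bsub>A\<^esub> ?I = (?m \<star>\<^bsub>A\<^esub> ?I) \<cdot> (?c \<otimes> ?I)"
      by (subst conv_comp) simp_all
    ultimately show ?thesis by simp
  qed
  have yb: "(?I \<otimes> ?c) \<cdot> sym_arr C (?A \<otimes>\<^sub>o ?A) ?A = (?c \<otimes> ?I) \<cdot> sym_arr C ?A (?A \<otimes>\<^sub>o ?A)"
  proof -
    have "(?I \<otimes> ?c) \<cdot> sym_arr C (?A \<otimes>\<^sub>o ?A) ?A = sym_arr C (?A \<otimes>\<^sub>o ?A) ?A \<cdot> (?c \<otimes> ?I)"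
      using sym_nat[of ?c ?I] by simp
    also have "\<dots> = (?c \<otimes> ?I) \<cdot> (?I \<otimes> ?c) \<cdot> (?c \<otimes> ?I)" by (simp add: sym_tensor_left)
    finally show ?thesis by (simp add: sym_tensor_right)
  qed
  have as: "?m \<star>\<^bsub>A\<^esub> ?I = ?I \<star>\<^bsub>A\<^esub> ?m" using A by (simp add: monoid_in_def conv_def)
  show "\<mu>\<^bsub>?O\<^esub> \<cdot> (\<mu>\<^bsub>?O\<^esub> \<otimes> \<one> (obj ?O)) = \<mu>\<^bsub>?O\<^esub> \<cdot> (\<one> (obj ?O) \<otimes> \<mu>\<^bsub>?O\<^esub>)"
    unfolding u[symmetric] op_monoid_simps L R yb as ..
qed (simp_all add: A)

text \<open>
  In \<open>A\<^sup>o\<^sup>p \<otimes> B\<close> a right factor \<open>a \<otimes> 1\<close> multiplies the first component from the left, as it does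
  in \<open>A \<otimes> B\<close> when it stands on the left. For a point \<open>a\<close> the symmetry is an identity.
\<close>

lemma conv_op_tensor_first:
  assumes A: "monoid_in C A" and B: "monoid_in C B"
    and "a \<in> Arr C" "f \<in> Arr C" "Cod C a = obj A" "Cod C f = obj A \<otimes>\<^sub>o obj B"
  shows "f \<star>\<^bsub>tensor_monoid C (op_monoid A) B\<^esub> (a \<otimes> \<eta>\<^bsub>B\<^esub>) =
    ((a \<otimes> \<eta>\<^bsub>B\<^esub>) \<star>\<^bsub>tensor_monoid C A B\<^esub> f) \<cdot> sym_arr C (Dom C f) (Dom C a)"
proof -
  let ?M = "tensor_monoid C A B" and ?E = "tensor_monoid C (op_monoid A) B"
  let ?A = "obj A" and ?B = "obj B" and ?X = "Dom C a"
  note [simp] = assms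
  \<comment> \<open>it is enough to treat the universal element, the identity of the tensor product\<close>
  have "(\<one> ?A \<otimes> \<one> ?B) \<star>\<^bsub>?E\<^esub> (a \<otimes> \<eta>\<^bsub>B\<^esub>)
    = ((\<one> ?A \<star>\<^bsub>op_monoid A\<^esub> a) \<otimes> \<one> ?B) \<cdot> (\<one> ?A \<otimes> sym_arr C ?B ?X)"
    by (subst conv_tensor) simp_all
  also have "(\<one> ?A \<star>\<^bsub>op_monoid A\<^esub> a) \<otimes> \<one> ?B = ((a \<star>\<^bsub>A\<^esub> \<one> ?A) \<otimes> \<one> ?B) \<cdot> (sym_arr C ?A ?X \<otimes> \<one> ?B)"
    by (simp add: conv_op tensor_comp)
  also have "(((a \<star>\<^bsub>A\<^esub> \<one> ?A) \<otimes> \<one> ?B) \<cdot> (sym_arr C ?A ?X \<otimes> \<one> ?B)) \<cdot> (\<one> ?A \<otimes> sym_arr C ?B ?X)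
    = ((a \<star>\<^bsub>A\<^esub> \<one> ?A) \<otimes> \<one> ?B) \<cdot> sym_arr C (?A \<otimes>\<^sub>o ?B) ?X"
    by (simp add: sym_tensor_left)
  also have "(a \<star>\<^bsub>A\<^esub> \<one> ?A) \<otimes> \<one> ?B = (a \<otimes> \<eta>\<^bsub>B\<^esub>) \<star>\<^bsub>?M\<^esub> (\<one> ?A \<otimes> \<one> ?B)"
    by (subst conv_tensor_point_middle) simp_all
  finally have 1: "\<one> (obj ?M) \<star>\<^bsub>?E\<^esub> (a \<otimes> \<eta>\<^bsub>B\<^esub>) = ((a \<otimes> \<eta>\<^bsub>B\<^esub>) \<star>\<^bsub>?M\<^esub> \<one> (obj ?M)) \<cdot> sym_arr C (?A \<otimes>\<^sub>o ?B) ?X"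
    by simp
  have "f \<star>\<^bsub>?E\<^esub> (a \<otimes> \<eta>\<^bsub>B\<^esub>) = (\<one> (obj ?M) \<star>\<^bsub>?E\<^esub> (a \<otimes> \<eta>\<^bsub>B\<^esub>)) \<cdot> (f \<otimes> \<one> ?X)"
    by (subst conv_comp) simp_all
  also have "\<dots> = ((a \<otimes> \<eta>\<^bsub>B\<^esub>) \<star>\<^bsub>?M\<^esub> \<one> (obj ?M)) \<cdot> sym_arr C (?A \<otimes>\<^sub>o ?B) ?X \<cdot> (f \<otimes> \<one> ?X)"
    unfolding 1 by simp
  also have "sym_arr C (?A \<otimes>\<^sub>o ?B) ?X \<cdot> (f \<otimes> \<one> ?X) = (\<one> ?X \<otimes> f) \<cdot> sym_arr C (Dom C f) ?X"
    using sym_nat[of f "\<one> ?X"] by simp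
  also have "((a \<otimes> \<eta>\<^bsub>B\<^esub>) \<star>\<^bsub>?M\<^esub> \<one> (obj ?M)) \<cdot> (\<one> ?X \<otimes> f) \<cdot> sym_arr C (Dom C f) ?X
    = (((a \<otimes> \<eta>\<^bsub>B\<^esub>) \<star>\<^bsub>?M\<^esub> \<one> (obj ?M)) \<cdot> (\<one> ?X \<otimes> f)) \<cdot> sym_arr C (Dom C f) ?X"
    by simp
  also have "((a \<otimes> \<eta>\<^bsub>B\<^esub>) \<star>\<^bsub>?M\<^esub> \<one> (obj ?M)) \<cdot> (\<one> ?X \<otimes> f) = (a \<otimes> \<eta>\<^bsub>B\<^esub>) \<star>\<^bsub>?M\<^esub> f"
    by (subst conv_comp) simp_all
  finally show ?thesis .
qed

lemma conv_op_tensor_second: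
  assumes A: "monoid_in C A" and B: "monoid_in C B"
    and "b \<in> Arr C" "f \<in> Arr C" "Cod C b = obj B" "Cod C f = obj A \<otimes>\<^sub>o obj B"
  shows "f \<star>\<^bsub>tensor_monoid C (op_monoid A) B\<^esub> (\<eta>\<^bsub>A\<^esub> \<otimes> b) = f \<star>\<^bsub>tensor_monoid C A B\<^esub> (\<eta>\<^bsub>A\<^esub> \<otimes> b)"
  using conv_second_right[of "op_monoid A" B b f] assms by (simp add: conv_second_right)

text \<open>
  The two sides arise from the bracketings of a threefold tensor product. The equality lets both
  \<open>\<delta> \<otimes> 1\<close> and \<open>1 \<otimes> \<delta>\<close> be morphisms into one monoid on \<open>H \<otimes> H \<otimes> H\<close>.
\<close>

lemma tensor_monoid_assoc:
  assumes A: "monoid_in C A" and B: "monoid_in C B" and D: "monoid_in C D"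
  shows "tensor_monoid C (tensor_monoid C A B) D = tensor_monoid C A (tensor_monoid C B D)"
proof -
  note [simp] = A B D
  let ?A = "obj A" and ?B = "obj B" and ?D = "obj D"
  let ?mA = "\<mu>\<^bsub>A\<^esub>" and ?mB = "\<mu>\<^bsub>B\<^esub>" and ?mD = "\<mu>\<^bsub>D\<^esub>"
  let ?L = "tensor_monoid C (tensor_monoid C A B) D" and ?R = "tensor_monoid C A (tensor_monoid C B D)"
  let ?ba = "sym_arr C ?B ?A" and ?da = "sym_arr C ?D ?A" and ?db = "sym_arr C ?D ?B"
  have AB: "\<mu>\<^bsub>tensor_monoid C A B\<^esub> \<otimes> ?mD = (?mA \<otimes> ?mB \<otimes> ?mD) \<cdot> (\<one> ?A \<otimes> ?ba \<otimes> \<one> ?B \<otimes> \<one> (?D \<otimes>\<^sub>o ?D))"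
    using tensor_comp[of "\<one> ?A \<otimes> ?ba \<otimes> \<one> ?B" "?mA \<otimes> ?mB" "\<one> (?D \<otimes>\<^sub>o ?D)" ?mD]
    by (simp add: tensor_monoid_def)
  have BD: "?mA \<otimes> \<mu>\<^bsub>tensor_monoid C B D\<^esub> = (?mA \<otimes> ?mB \<otimes> ?mD) \<cdot> (\<one> (?A \<otimes>\<^sub>o ?A) \<otimes> \<one> ?B \<otimes> ?db \<otimes> \<one> ?D)"
    using tensor_comp[of "\<one> (?A \<otimes>\<^sub>o ?A)" ?mA "\<one> ?B \<otimes> ?db \<otimes> \<one> ?D" "?mB \<otimes> ?mD"]
    by (simp add: tensor_monoid_def)
  have L0: "\<mu>\<^bsub>?L\<^esub> = (\<mu>\<^bsub>tensor_monoid C A B\<^esub> \<otimes> ?mD) \<cdot> (\<one> (?A \<otimes>\<^sub>o ?B) \<otimes> sym_arr C ?D (?A \<otimes>\<^sub>o ?B) \<otimes> \<one> ?D)"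
    by (simp add: tensor_monoid_def)
  have R0: "\<mu>\<^bsub>?R\<^esub> = (?mA \<otimes> \<mu>\<^bsub>tensor_monoid C B D\<^esub>) \<cdot> (\<one> ?A \<otimes> sym_arr C (?B \<otimes>\<^sub>o ?D) ?A \<otimes> \<one> (?B \<otimes>\<^sub>o ?D))"
    by (simp add: tensor_monoid_def)
  have cL: "(\<one> ?A \<otimes> ?ba \<otimes> \<one> ?B \<otimes> \<one> (?D \<otimes>\<^sub>o ?D)) \<cdot> (\<one> (?A \<otimes>\<^sub>o ?B) \<otimes> sym_arr C ?D (?A \<otimes>\<^sub>o ?B) \<otimes> \<one> ?D)
    = \<one> ?A \<otimes> ((?ba \<otimes> \<one> (?B \<otimes>\<^sub>o ?D)) \<cdot> (\<one> ?B \<otimes> sym_arr C ?D (?A \<otimes>\<^sub>o ?B))) \<otimes> \<one> ?D"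
    using tensor_comp[of "\<one> ?A" "\<one> ?A" "(\<one> ?B \<otimes> sym_arr C ?D (?A \<otimes>\<^sub>o ?B)) \<otimes> \<one> ?D" "(?ba \<otimes> \<one> (?B \<otimes>\<^sub>o ?D)) \<otimes> \<one> ?D"]
      tensor_comp[of "\<one> ?B \<otimes> sym_arr C ?D (?A \<otimes>\<^sub>o ?B)" "?ba \<otimes> \<one> (?B \<otimes>\<^sub>o ?D)" "\<one> ?D" "\<one> ?D"]
    by simp
  have cR: "(\<one> (?A \<otimes>\<^sub>o ?A) \<otimes> \<one> ?B \<otimes> ?db \<otimes> \<one> ?D) \<cdot> (\<one> ?A \<otimes> sym_arr C (?B \<otimes>\<^sub>o ?D) ?A \<otimes> \<one> (?B \<otimes>\<^sub>o ?D))
    = \<one> ?A \<otimes> ((\<one> (?A \<otimes>\<^sub>o ?B) \<otimes> ?db) \<cdot> (sym_arr C (?B \<otimes>\<^sub>o ?D) ?A \<otimes> \<one> ?B)) \<otimes> \<one> ?D"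
    using tensor_comp[of "\<one> ?A" "\<one> ?A" "(sym_arr C (?B \<otimes>\<^sub>o ?D) ?A \<otimes> \<one> ?B) \<otimes> \<one> ?D" "(\<one> (?A \<otimes>\<^sub>o ?B) \<otimes> ?db) \<otimes> \<one> ?D"]
      tensor_comp[of "sym_arr C (?B \<otimes>\<^sub>o ?D) ?A \<otimes> \<one> ?B" "\<one> (?A \<otimes>\<^sub>o ?B) \<otimes> ?db" "\<one> ?D" "\<one> ?D"]
    by simp
  have "(?ba \<otimes> \<one> (?B \<otimes>\<^sub>o ?D)) \<cdot> (\<one> ?B \<otimes> sym_arr C ?D (?A \<otimes>\<^sub>o ?B))
     = (?ba \<otimes> ?db) \<cdot> (\<one> ?B \<otimes> ?da \<otimes> \<one> ?B)"
  proof -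
    have "\<one> ?B \<otimes> sym_arr C ?D (?A \<otimes>\<^sub>o ?B) = (\<one> (?B \<otimes>\<^sub>o ?A) \<otimes> ?db) \<cdot> (\<one> ?B \<otimes> ?da \<otimes> \<one> ?B)"
      using tensor_comp[of "\<one> ?B" "\<one> ?B" "?da \<otimes> \<one> ?B" "\<one> ?A \<otimes> ?db"] by (simp add: sym_tensor_right)
    then show ?thesis
      using tensor_comp_assoc[of "\<one> (?B \<otimes>\<^sub>o ?A)" ?ba ?db "\<one> (?B \<otimes>\<^sub>o ?D)" "\<one> ?B \<otimes> ?da \<otimes> \<one> ?B"] by simp
  qed
  also have "\<dots> = (\<one> (?A \<otimes>\<^sub>o ?B) \<otimes> ?db) \<cdot> (sym_arr C (?B \<otimes>\<^sub>o ?D) ?A \<otimes> \<one> ?B)"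
  proof -
    have "sym_arr C (?B \<otimes>\<^sub>o ?D) ?A \<otimes> \<one> ?B = (?ba \<otimes> \<one> (?D \<otimes>\<^sub>o ?B)) \<cdot> (\<one> ?B \<otimes> ?da \<otimes> \<one> ?B)"
      using tensor_comp[of "\<one> ?B \<otimes> ?da" "?ba \<otimes> \<one> ?D" "\<one> ?B" "\<one> ?B"] by (simp add: sym_tensor_left)
    then show ?thesis
      using tensor_comp_assoc[of ?ba "\<one> (?A \<otimes>\<^sub>o ?B)" "\<one> (?D \<otimes>\<^sub>o ?B)" ?db "\<one> ?B \<otimes> ?da \<otimes> \<one> ?B"] by simp
  qed
  finally have mid: "(?ba \<otimes> \<one> (?B \<otimes>\<^sub>o ?D)) \<cdot> (\<one> ?B \<otimes> sym_arr C ?D (?A \<otimes>\<^sub>o ?B))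
     = (\<one> (?A \<otimes>\<^sub>o ?B) \<otimes> ?db) \<cdot> (sym_arr C (?B \<otimes>\<^sub>o ?D) ?A \<otimes> \<one> ?B)" .
  have "\<mu>\<^bsub>?L\<^esub> = (?mA \<otimes> ?mB \<otimes> ?mD) \<cdot>
      (\<one> ?A \<otimes> ((?ba \<otimes> \<one> (?B \<otimes>\<^sub>o ?D)) \<cdot> (\<one> ?B \<otimes> sym_arr C ?D (?A \<otimes>\<^sub>o ?B))) \<otimes> \<one> ?D)"
    unfolding cL[symmetric] L0 AB by (rule comp_reassoc) simp_all
  also have "\<dots> = \<mu>\<^bsub>?R\<^esub>"
    unfolding mid cR[symmetric] R0 BD by (rule comp_reassoc[symmetric]) simp_all
  finally have "\<mu>\<^bsub>?L\<^esub> = \<mu>\<^bsub>?R\<^esub>" .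
  moreover have "obj ?L = obj ?R" "\<eta>\<^bsub>?L\<^esub> = \<eta>\<^bsub>?R\<^esub>" by simp_all
  ultimately show ?thesis by (metis (mono_tags) monoid_data.equality unit.exhaust)
qed

definition monoid_hom :: "('a, 'b, 'x) monoid_data_scheme \<Rightarrow> ('a, 'b, 'y) monoid_data_scheme \<Rightarrow> 'b \<Rightarrow> bool" where
  "monoid_hom A B \<phi> \<longleftrightarrow> monoid_in C A \<and> monoid_in C B \<and> \<phi> \<in> hom C (obj A) (obj B) \<and>
     \<phi> \<cdot> \<eta>\<^bsub>A\<^esub> = \<eta>\<^bsub>B\<^esub> \<and> \<phi> \<cdot> \<mu>\<^bsub>A\<^esub> = \<phi> \<star>\<^bsub>B\<^esub> \<phi>"

lemma monoid_hom_conv: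
  assumes h: "monoid_hom A B \<phi>" and [simp]: "f \<in> Arr C" "g \<in> Arr C" "Cod C f = obj A" "Cod C g = obj A"
  shows "\<phi> \<cdot> (f \<star>\<^bsub>A\<^esub> g) = (\<phi> \<cdot> f) \<star>\<^bsub>B\<^esub> (\<phi> \<cdot> g)"
proof -
  have [simp]: "monoid_in C A" "monoid_in C B" "\<phi> \<in> Arr C" "Dom C \<phi> = obj A" "Cod C \<phi> = obj B"
    and m: "\<phi> \<cdot> \<mu>\<^bsub>A\<^esub> = \<phi> \<star>\<^bsub>B\<^esub> \<phi>"
    using h by (auto simp: monoid_hom_def hom_iff)
  have "\<phi> \<cdot> (f \<star>\<^bsub>A\<^esub> g) = (\<phi> \<cdot> \<mu>\<^bsub>A\<^esub>) \<cdot> (f \<otimes> g)" by (simp add: conv_def)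
  then show ?thesis unfolding m by (simp add: conv_comp)
qed

lemma monoid_hom_id: "monoid_in C A \<Longrightarrow> monoid_hom A A (\<one> (obj A))"
  by (simp add: monoid_hom_def hom_iff mu_eq_conv)

lemma monoid_hom_tensor:
  assumes p: "monoid_hom A A' \<phi>" and q: "monoid_hom B B' \<psi>"
  shows "monoid_hom (tensor_monoid C A B) (tensor_monoid C A' B') (\<phi> \<otimes> \<psi>)"
proof -
  have [simp]: "monoid_in C A" "monoid_in C A'" "\<phi> \<in> Arr C" "Dom C \<phi> = obj A" "Cod C \<phi> = obj A'"
    "monoid_in C B" "monoid_in C B'" "\<psi> \<in> Arr C" "Dom C \<psi> = obj B" "Cod C \<psi> = obj B'"
    and e: "\<phi> \<cdot> \<eta>\<^bsub>A\<^esub> = \<eta>\<^bsub>A'\<^esub>" "\<psi> \<cdot> \<eta>\<^bsub>B\<^esub> = \<eta>\<^bsub>B'\<^esub>"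
    and m: "\<phi> \<cdot> \<mu>\<^bsub>A\<^esub> = \<phi> \<star>\<^bsub>A'\<^esub> \<phi>" "\<psi> \<cdot> \<mu>\<^bsub>B\<^esub> = \<psi> \<star>\<^bsub>B'\<^esub> \<psi>"
    using p q by (auto simp: monoid_hom_def hom_iff)
  have "(\<phi> \<otimes> \<psi>) \<cdot> \<mu>\<^bsub>tensor_monoid C A B\<^esub> = ((\<phi> \<otimes> \<psi>) \<cdot> (\<mu>\<^bsub>A\<^esub> \<otimes> \<mu>\<^bsub>B\<^esub>)) \<cdot>
      (\<one> (obj A) \<otimes> sym_arr C (obj B) (obj A) \<otimes> \<one> (obj B))"
    by (simp add: tensor_monoid_def)
  also have "(\<phi> \<otimes> \<psi>) \<cdot> (\<mu>\<^bsub>A\<^esub> \<otimes> \<mu>\<^bsub>B\<^esub>) = (\<phi> \<star>\<^bsub>A'\<^esub> \<phi>) \<otimes> (\<psi> \<star>\<^bsub>B'\<^esub> \<psi>)"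
    by (simp add: tensor_comp m)
  also have "\<dots> \<cdot> (\<one> (obj A) \<otimes> sym_arr C (obj B) (obj A) \<otimes> \<one> (obj B))
      = (\<phi> \<otimes> \<psi>) \<star>\<^bsub>tensor_monoid C A' B'\<^esub> (\<phi> \<otimes> \<psi>)"
    by (subst conv_tensor) simp_all
  finally show ?thesis
    by (simp add: monoid_hom_def hom_iff tensor_comp e)
qed

text \<open>
  With the unit object as a monoid, a multiplicative counit is a morphism of monoids, and applying it
  to one leg becomes a special case of \<open>monoid_hom_tensor\<close>.
\<close>

definition unit_monoid :: "('a, 'b) monoid_data" where
  "unit_monoid = \<lparr>obj = \<K>, eta = \<one> \<K>, mu = \<one> \<K>\<rparr>"

lemma unit_monoid_simps [simp]:
  "obj unit_monoid = \<K>" "\<eta>\<^bsub>unit_monoid\<^esub> = \<one> \<K>" "\<mu>\<^bsub>unit_monoid\<^esub> = \<one> \<K>"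
  by (simp_all add: unit_monoid_def)

lemma monoid_unit: "monoid_in C unit_monoid"
  by (rule monoid_inI) simp_all

lemma conv_tensor_unit:
  assumes "monoid_in C A"
  shows "f \<star>\<^bsub>tensor_monoid C A unit_monoid\<^esub> g = f \<star>\<^bsub>A\<^esub> g"
    "f \<star>\<^bsub>tensor_monoid C unit_monoid A\<^esub> g = f \<star>\<^bsub>A\<^esub> g"
  using assms by (simp_all add: conv_def tensor_monoid_def)

lemma counit_conv:
  assumes A: "monoid_in C A" and e: "monoid_hom B unit_monoid e"
    and f: "f \<in> Arr C" "g \<in> Arr C"
  shows "Cod C f = obj A \<otimes>\<^sub>o obj B \<Longrightarrow> Cod C g = obj A \<otimes>\<^sub>o obj B \<Longrightarrow>
      (\<one> (obj A) \<otimes> e) \<cdot> (f \<star>\<^bsub>tensor_monoid C A B\<^esub> g) =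
      ((\<one> (obj A) \<otimes> e) \<cdot> f) \<star>\<^bsub>A\<^esub> ((\<one> (obj A) \<otimes> e) \<cdot> g)"
    "Cod C f = obj B \<otimes>\<^sub>o obj A \<Longrightarrow> Cod C g = obj B \<otimes>\<^sub>o obj A \<Longrightarrow>
      (e \<otimes> \<one> (obj A)) \<cdot> (f \<star>\<^bsub>tensor_monoid C B A\<^esub> g) =
      ((e \<otimes> \<one> (obj A)) \<cdot> f) \<star>\<^bsub>A\<^esub> ((e \<otimes> \<one> (obj A)) \<cdot> g)"
  using monoid_hom_conv[OF monoid_hom_tensor[OF monoid_hom_id[OF A] e], of f g]
    monoid_hom_conv[OF monoid_hom_tensor[OF e monoid_hom_id[OF A]], of f g] f
  by (simp_all add: conv_tensor_unit A)

end

section \<open>The fusion map of a left Hopf coquasigroup\<close>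

text \<open>
  On elements, \<open>T\<close> is the fusion map \<open>a \<otimes> h \<mapsto> a h\<^sub>1 \<otimes> h\<^sub>2\<close>, and \<open>S\<close> is
  \<open>a \<otimes> h \<mapsto> a \<lambda>(h\<^sub>1) \<otimes> h\<^sub>2\<close>. The monoids \<open>B\<close> and \<open>E\<close> are \<open>H \<otimes> H\<close> and \<open>H\<^sup>o\<^sup>p \<otimes> H\<close>; they live
  on the same object, and their products are \<open>\<bullet>\<close> and \<open>\<odot>\<close>. The embeddings \<open>i1\<close> and \<open>i2\<close> of \<open>H\<close> into
  either leg generate the universal element: \<open>i1 \<bullet> i2\<close> is the identity of \<open>H \<otimes> H\<close>.
\<close>

locale left_Hopf = strict_symmetric_monoidal_category C
  for C :: "('o, 'm) smcat" (structure) +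
  fixes H :: "('o, 'm) bimonoid_data" and l :: 'm
  assumes bimonoid: "noncoassoc_bimonoid C H" and antipode: "left_antipode C H l"
begin

abbreviation I where "I \<equiv> \<one> (obj H)"
abbreviation B where "B \<equiv> tensor_monoid C H H"
abbreviation E where "E \<equiv> tensor_monoid C (op_monoid H) H"
abbreviation conv_H (infixr "\<diamondop>" 60) where "f \<diamondop> g \<equiv> conv C H f g"
abbreviation conv_B (infixr "\<bullet>" 60) where "f \<bullet> g \<equiv> conv C B f g"
abbreviation conv_E (infixr "\<odot>" 60) where "f \<odot> g \<equiv> conv C E f g"
abbreviation i1 where "i1 \<equiv> I \<otimes> \<eta>\<^bsub>H\<^esub>"
abbreviation i2 where "i2 \<equiv> \<eta>\<^bsub>H\<^esub> \<otimes> I"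
abbreviation T where "T \<equiv> i1 \<bullet> \<delta>\<^bsub>H\<^esub>"
abbreviation \<tau> where "\<tau> \<equiv> (l \<otimes> I) \<cdot> \<delta>\<^bsub>H\<^esub>"
abbreviation S where "S \<equiv> i1 \<bullet> \<tau>"

lemma monoid_H [simp]: "monoid_in C H"
  using bimonoid by (simp add: noncoassoc_bimonoid_def)

lemma structure_arr [simp]:
  "\<epsilon>\<^bsub>H\<^esub> \<in> Arr C" "Dom C \<epsilon>\<^bsub>H\<^esub> = obj H" "Cod C \<epsilon>\<^bsub>H\<^esub> = \<K>"
  "\<delta>\<^bsub>H\<^esub> \<in> Arr C" "Dom C \<delta>\<^bsub>H\<^esub> = obj H" "Cod C \<delta>\<^bsub>H\<^esub> = obj H \<otimes>\<^sub>o obj H"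
  "l \<in> Arr C" "Dom C l = obj H" "Cod C l = obj H"
  using bimonoid antipode
  by (auto simp: noncoassoc_bimonoid_def counital_comagma_def left_antipode_def hom_iff)

lemma counit [simp]:
  "(\<epsilon>\<^bsub>H\<^esub> \<otimes> I) \<cdot> \<delta>\<^bsub>H\<^esub> = I" "(I \<otimes> \<epsilon>\<^bsub>H\<^esub>) \<cdot> \<delta>\<^bsub>H\<^esub> = I" "\<epsilon>\<^bsub>H\<^esub> \<cdot> \<eta>\<^bsub>H\<^esub> = \<one> \<K>"
  and delta_eta [simp]: "\<delta>\<^bsub>H\<^esub> \<cdot> \<eta>\<^bsub>H\<^esub> = \<eta>\<^bsub>H\<^esub> \<otimes> \<eta>\<^bsub>H\<^esub>"
  using bimonoid by (auto simp: noncoassoc_bimonoid_def counital_comagma_def)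

lemma hom_delta: "monoid_hom H B \<delta>\<^bsub>H\<^esub>"
  using bimonoid by (simp add: monoid_hom_def hom_iff noncoassoc_bimonoid_def conv_def)

lemma hom_eps: "monoid_hom H unit_monoid \<epsilon>\<^bsub>H\<^esub>"
  using bimonoid by (simp add: monoid_hom_def monoid_unit hom_iff noncoassoc_bimonoid_def conv_def)

lemma unit_BE [simp]:
  assumes "f \<in> Arr C" "Cod C f = obj H \<otimes>\<^sub>o obj H"
  shows "(\<eta>\<^bsub>H\<^esub> \<otimes> \<eta>\<^bsub>H\<^esub>) \<bullet> f = f" "f \<bullet> (\<eta>\<^bsub>H\<^esub> \<otimes> \<eta>\<^bsub>H\<^esub>) = f"
    "(\<eta>\<^bsub>H\<^esub> \<otimes> \<eta>\<^bsub>H\<^esub>) \<odot> f = f" "f \<odot> (\<eta>\<^bsub>H\<^esub> \<otimes> \<eta>\<^bsub>H\<^esub>) = f"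
  using conv_unit[of B f] conv_unit[of E f] assms by simp_all

lemma first_comp:
  assumes "a \<in> Arr C" "Cod C a = obj H" shows "i1 \<cdot> a = a \<otimes> \<eta>\<^bsub>H\<^esub>"
  using assms tensor_comp[of a I "\<one> \<K>" "\<eta>\<^bsub>H\<^esub>"] by simp

lemma second_comp:
  assumes "a \<in> Arr C" "Cod C a = obj H" shows "i2 \<cdot> a = \<eta>\<^bsub>H\<^esub> \<otimes> a"
  using assms tensor_comp[of "\<one> \<K>" "\<eta>\<^bsub>H\<^esub>" a I] by simp

lemma first_mult:
  assumes "a \<in> Arr C" "Cod C a = obj H" "b \<in> Arr C" "Cod C b = obj H"
  shows "(a \<otimes> \<eta>\<^bsub>H\<^esub>) \<bullet> (b \<otimes> \<eta>\<^bsub>H\<^esub>) = (a \<diamondop> b) \<otimes> \<eta>\<^bsub>H\<^esub>"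
  using assms by (subst conv_tensor_point_middle) simp_all

lemma second_mult:
  assumes "a \<in> Arr C" "Cod C a = obj H" "b \<in> Arr C" "Cod C b = obj H"
  shows "(\<eta>\<^bsub>H\<^esub> \<otimes> a) \<bullet> (\<eta>\<^bsub>H\<^esub> \<otimes> b) = \<eta>\<^bsub>H\<^esub> \<otimes> (a \<diamondop> b)"
  using assms by (subst conv_tensor_point_middle) simp_all

lemma first_second:
  assumes "a \<in> Arr C" "Cod C a = obj H" "b \<in> Arr C" "Cod C b = obj H"
  shows "(a \<otimes> \<eta>\<^bsub>H\<^esub>) \<bullet> (\<eta>\<^bsub>H\<^esub> \<otimes> b) = a \<otimes> b" "(a \<otimes> \<eta>\<^bsub>H\<^esub>) \<odot> (\<eta>\<^bsub>H\<^esub> \<otimes> b) = a \<otimes> b"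
  using assms
    conv_tensor_point_middle[of H H a "\<eta>\<^bsub>H\<^esub>" "\<eta>\<^bsub>H\<^esub>" b]
    conv_tensor_point_middle[of "op_monoid H" H a "\<eta>\<^bsub>H\<^esub>" "\<eta>\<^bsub>H\<^esub>" b]
    conv_unit[of "op_monoid H" a] by simp_all

text \<open>
  The map \<open>i1 \<bullet> g\<close> is \<open>a \<otimes> h \<mapsto> (a \<otimes> 1) g(h)\<close>, the extension of \<open>g\<close> to a left \<open>H\<close>-linear map on
  \<open>H \<otimes> H\<close>.
\<close>

lemma lin_linear:
  assumes [simp]: "g \<in> Arr C" "Dom C g = obj H" "Cod C g = obj H \<otimes>\<^sub>o obj H"
    "a \<in> Arr C" "Cod C a = obj H" "f \<in> Arr C" "Cod C f = obj H \<otimes>\<^sub>o obj H"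
  shows "(i1 \<bullet> g) \<cdot> ((a \<otimes> \<eta>\<^bsub>H\<^esub>) \<bullet> f) = (a \<otimes> \<eta>\<^bsub>H\<^esub>) \<bullet> ((i1 \<bullet> g) \<cdot> f)"
proof -
  have "(i1 \<bullet> g) \<cdot> (\<mu>\<^bsub>H\<^esub> \<otimes> I) = (i1 \<cdot> \<mu>\<^bsub>H\<^esub>) \<bullet> g"
    by (subst conv_comp) simp_all
  also have "i1 \<cdot> \<mu>\<^bsub>H\<^esub> = i1 \<bullet> i1"
    by (simp add: first_comp first_mult mu_eq_conv)
  also have "(i1 \<bullet> i1) \<bullet> g = i1 \<bullet> (i1 \<bullet> g)"
    by (simp add: conv_assoc)
  finally have 1: "(i1 \<bullet> g) \<cdot> (\<mu>\<^bsub>H\<^esub> \<otimes> I) = i1 \<bullet> (i1 \<bullet> g)" .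
  have "(i1 \<bullet> g) \<cdot> ((a \<otimes> \<eta>\<^bsub>H\<^esub>) \<bullet> f) = ((i1 \<bullet> g) \<cdot> (\<mu>\<^bsub>H\<^esub> \<otimes> I)) \<cdot> (a \<otimes> f)"
    by (simp add: conv_first_left)
  then show ?thesis unfolding 1 by (simp add: conv_comp first_comp)
qed

lemma lin_second [simp]:
  assumes "g \<in> Arr C" "Dom C g = obj H" "Cod C g = obj H \<otimes>\<^sub>o obj H"
  shows "(i1 \<bullet> g) \<cdot> i2 = g"
  using assms by (subst conv_comp) (simp_all add: first_comp)

lemma lin_alt:
  assumes "g \<in> Arr C" "Cod C g = obj H \<otimes>\<^sub>o obj H"
  shows "i1 \<bullet> g = (\<mu>\<^bsub>H\<^esub> \<otimes> I) \<cdot> (I \<otimes> g)"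
  using assms by (simp add: conv_first_left)

text \<open>
  For an arbitrary coproduct \<open>g\<close>, the antipode equations for \<open>k\<close> say that the linear
  extensions of \<open>g\<close> and of \<open>(k \<otimes> 1) g\<close> are inverse to each other on the elements \<open>1 \<otimes> h\<close>. This form serves both the given and the deformed
  coproduct.
\<close>

lemma left_antipode_iff:
  assumes g: "g \<in> Arr C" "Dom C g = obj H" "Cod C g = obj H \<otimes>\<^sub>o obj H"
  shows "left_antipode C (H\<lparr>delta := g\<rparr>) k \<longleftrightarrow> k \<in> hom C (obj H) (obj H) \<and>
    (i1 \<bullet> g) \<cdot> (k \<otimes> I) \<cdot> g = i2 \<and> (i1 \<bullet> ((k \<otimes> I) \<cdot> g)) \<cdot> g = i2"
proof (cases "k \<in> hom C (obj H) (obj H)")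
  case True
  then have k [simp]: "k \<in> Arr C" "Dom C k = obj H" "Cod C k = obj H" by (auto simp: hom_iff)
  note [simp] = g
  have 1: "(\<mu>\<^bsub>H\<^esub> \<otimes> I) \<cdot> (k \<otimes> g) \<cdot> g = (i1 \<bullet> g) \<cdot> (k \<otimes> I) \<cdot> g"
    by (simp add: lin_alt tensor_comp_assoc)
  have 2: "(\<mu>\<^bsub>H\<^esub> \<otimes> I) \<cdot> (I \<otimes> ((k \<otimes> I) \<cdot> g)) \<cdot> g = (i1 \<bullet> ((k \<otimes> I) \<cdot> g)) \<cdot> g"
    by (simp add: lin_alt)
  show ?thesis unfolding left_antipode_def by (simp add: 1 2 True)
qed (simp add: left_antipode_def)

lemma T_tau: "T \<cdot> \<tau> = i2" and S_delta: "S \<cdot> \<delta>\<^bsub>H\<^esub> = i2"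
  using left_antipode_iff[of "\<delta>\<^bsub>H\<^esub>" l] antipode by simp_all

text \<open>
  By linearity it is enough that the composites fix \<open>1 \<otimes> h\<close>.
\<close>

lemma T_S: "T \<cdot> S = \<one> (obj H \<otimes>\<^sub>o obj H)"
  by (subst lin_linear) (simp_all add: T_tau first_second)

lemma S_T: "S \<cdot> T = \<one> (obj H \<otimes>\<^sub>o obj H)"
  by (subst lin_linear) (simp_all add: S_delta first_second)

lemma S_eqI:
  assumes "f \<in> Arr C" "g \<in> Arr C" "Cod C f = obj H \<otimes>\<^sub>o obj H" "Cod C g = obj H \<otimes>\<^sub>o obj H" "T \<cdot> f = g"
  shows "S \<cdot> g = f"
proof -
  have "S \<cdot> g = (S \<cdot> T) \<cdot> f" using assms(1-4) unfolding assms(5)[symmetric]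
    by (subst comp_reassoc) simp_all
  then show ?thesis using assms(1-4) by (simp only: S_T comp_Id)
qed

text \<open>
  On elements: \<open>T(a \<otimes> h y) = T(a \<otimes> h) \<delta>(y)\<close>, since \<open>\<delta>\<close> is multiplicative.
\<close>

lemma T_right:
  assumes [simp]: "f \<in> Arr C" "Cod C f = obj H \<otimes>\<^sub>o obj H" "y \<in> Arr C" "Cod C y = obj H"
  shows "T \<cdot> (f \<odot> (\<eta>\<^bsub>H\<^esub> \<otimes> y)) = (T \<cdot> f) \<bullet> (\<delta>\<^bsub>H\<^esub> \<cdot> y)"
proof -
  let ?id = "\<one> (obj H \<otimes>\<^sub>o obj H)"
  have "(I \<otimes> I) \<bullet> (\<eta>\<^bsub>H\<^esub> \<otimes> y) = I \<otimes> (I \<diamondop> y)"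
    by (subst conv_tensor_point_middle) simp_all
  then have 1: "?id \<odot> (\<eta>\<^bsub>H\<^esub> \<otimes> y) = I \<otimes> (I \<diamondop> y)"
    by (simp add: conv_op_tensor_second)
  have "T \<cdot> (?id \<odot> (\<eta>\<^bsub>H\<^esub> \<otimes> y)) = i1 \<bullet> (\<delta>\<^bsub>H\<^esub> \<cdot> (I \<diamondop> y))"
    unfolding 1 by (simp add: conv_comp)
  also have "\<dots> = T \<bullet> (\<delta>\<^bsub>H\<^esub> \<cdot> y)"
    by (simp add: monoid_hom_conv[OF hom_delta] conv_assoc)
  finally have 2: "T \<cdot> (?id \<odot> (\<eta>\<^bsub>H\<^esub> \<otimes> y)) = T \<bullet> (\<delta>\<^bsub>H\<^esub> \<cdot> y)" .
  have "f \<odot> (\<eta>\<^bsub>H\<^esub> \<otimes> y) = (?id \<odot> (\<eta>\<^bsub>H\<^esub> \<otimes> y)) \<cdot> (f \<otimes> \<one> (Dom C y))"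
    by (subst conv_comp) simp_all
  then have "T \<cdot> (f \<odot> (\<eta>\<^bsub>H\<^esub> \<otimes> y)) = (T \<cdot> (?id \<odot> (\<eta>\<^bsub>H\<^esub> \<otimes> y))) \<cdot> (f \<otimes> \<one> (Dom C y))"
    by simp
  then show ?thesis unfolding 2 by (simp add: conv_comp)
qed

text \<open>
  On elements: for \<open>f = a \<otimes> k\<close> one has \<open>T(a \<lambda>(h\<^sub>1) \<otimes> h\<^sub>2 k) = (a \<otimes> 1) (1 \<otimes> h) \<delta>(k)\<close>, by
  linearity in \<open>a\<close>, the antipode equation for \<open>h\<close> and \<open>T_right\<close> for \<open>k\<close>.
\<close>

lemma T_left:
  assumes [simp]: "f \<in> Arr C" "Cod C f = obj H \<otimes>\<^sub>o obj H"
  shows "T \<cdot> (\<tau> \<odot> f) = i2 \<bullet> (T \<cdot> f)"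
proof -
  let ?id = "\<one> (obj H \<otimes>\<^sub>o obj H)" and ?c = "sym_arr C (obj H) (obj H)"
  have Ti1: "T \<cdot> i1 = i1" by (simp add: conv_comp)
  \<comment> \<open>the case \<open>f = a \<otimes> 1\<close>: the factors \<open>a\<close> and \<open>h\<close> change places, hence the symmetry\<close>
  have "\<tau> \<odot> i1 = S \<cdot> ?c" by (simp add: conv_op_tensor_first)
  then have "T \<cdot> (\<tau> \<odot> i1) = (T \<cdot> S) \<cdot> ?c" by simp
  also have "\<dots> = i2 \<bullet> i1"
    unfolding T_S by (simp add: conv_second_left)
  finally have 1: "T \<cdot> (\<tau> \<odot> i1) = i2 \<bullet> i1" .
  \<comment> \<open>the case of the identity, that is, of the universal \<open>a \<otimes> k\<close>\<close>
  have "\<tau> \<odot> ?id = \<tau> \<odot> (i1 \<odot> i2)" by (simp add: first_second)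
  also have "\<dots> = (\<tau> \<odot> i1) \<odot> i2" by (rule conv_assoc[symmetric]) simp_all
  finally have "T \<cdot> (\<tau> \<odot> ?id) = (i2 \<bullet> i1) \<bullet> \<delta>\<^bsub>H\<^esub>"
    by (simp add: T_right 1)
  also have "\<dots> = i2 \<bullet> T" by (rule conv_assoc) simp_all
  finally have "T \<cdot> (\<tau> \<odot> ?id) = i2 \<bullet> T" .
  moreover have "\<tau> \<odot> f = (\<tau> \<odot> ?id) \<cdot> (I \<otimes> f)"
    by (subst conv_comp) simp_all
  ultimately have "T \<cdot> (\<tau> \<odot> f) = (i2 \<bullet> T) \<cdot> (I \<otimes> f)"
    by (simp flip: comp_reassoc)
  then show ?thesis by (simp add: conv_comp)
qed

lemma eps_tau: "(I \<otimes> \<epsilon>\<^bsub>H\<^esub>) \<cdot> \<tau> = l"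
proof -
  have "(I \<otimes> \<epsilon>\<^bsub>H\<^esub>) \<cdot> \<tau> = (l \<otimes> \<epsilon>\<^bsub>H\<^esub>) \<cdot> \<delta>\<^bsub>H\<^esub>"
    by (simp add: tensor_comp_assoc)
  also have "l \<otimes> \<epsilon>\<^bsub>H\<^esub> = l \<cdot> (I \<otimes> \<epsilon>\<^bsub>H\<^esub>)"
    using tensor_comp[of I l "\<epsilon>\<^bsub>H\<^esub>" "\<one> \<K>"] by simp
  finally show ?thesis by simp
qed

text \<open>
  Both sides have the image \<open>1 \<otimes> g h\<close> under the injective map \<open>T\<close>.
\<close>

lemma tau_mult: "\<tau> \<cdot> \<mu>\<^bsub>H\<^esub> = \<tau> \<odot> \<tau>"
proof -
  have "S \<cdot> (i2 \<cdot> \<mu>\<^bsub>H\<^esub>) = \<tau> \<odot> \<tau>"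
    by (rule S_eqI) (simp_all add: T_left T_tau second_mult second_comp mu_eq_conv)
  moreover have "S \<cdot> (i2 \<cdot> \<mu>\<^bsub>H\<^esub>) = \<tau> \<cdot> \<mu>\<^bsub>H\<^esub>"
    using comp_reassoc[of "\<mu>\<^bsub>H\<^esub>" i2 S] by simp
  ultimately show ?thesis by simp
qed

lemma antipode_unit: "l \<cdot> \<eta>\<^bsub>H\<^esub> = \<eta>\<^bsub>H\<^esub>"
proof -
  have te: "\<tau> \<cdot> \<eta>\<^bsub>H\<^esub> = (l \<cdot> \<eta>\<^bsub>H\<^esub>) \<otimes> \<eta>\<^bsub>H\<^esub>" by (simp add: tensor_comp)
  have "\<eta>\<^bsub>H\<^esub> \<otimes> \<eta>\<^bsub>H\<^esub> = (T \<cdot> \<tau>) \<cdot> \<eta>\<^bsub>H\<^esub>" unfolding T_tau by (simp add: second_comp)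
  also have "\<dots> = T \<cdot> (\<tau> \<cdot> \<eta>\<^bsub>H\<^esub>)" by (subst comp_reassoc) simp_all
  also have "\<dots> = (l \<cdot> \<eta>\<^bsub>H\<^esub>) \<otimes> \<eta>\<^bsub>H\<^esub>" unfolding te by (simp add: conv_comp first_comp)
  finally have "(I \<otimes> \<epsilon>\<^bsub>H\<^esub>) \<cdot> (\<eta>\<^bsub>H\<^esub> \<otimes> \<eta>\<^bsub>H\<^esub>) = (I \<otimes> \<epsilon>\<^bsub>H\<^esub>) \<cdot> ((l \<cdot> \<eta>\<^bsub>H\<^esub>) \<otimes> \<eta>\<^bsub>H\<^esub>)" by simp
  then show ?thesis by (simp add: tensor_comp)
qed

text \<open>
  Antimultiplicativity is the image of \<open>tau_mult\<close> under the counit on the second leg.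
\<close>

lemma hom_antipode: "monoid_hom H (op_monoid H) l"
proof -
  have "l \<cdot> \<mu>\<^bsub>H\<^esub> = (I \<otimes> \<epsilon>\<^bsub>H\<^esub>) \<cdot> (\<tau> \<cdot> \<mu>\<^bsub>H\<^esub>)"
    using comp_reassoc[of "\<mu>\<^bsub>H\<^esub>" \<tau> "I \<otimes> \<epsilon>\<^bsub>H\<^esub>"] eps_tau by simp
  also have "\<dots> = l \<star>\<^bsub>op_monoid H\<^esub> l"
    unfolding tau_mult using counit_conv(1)[OF monoid_op[OF monoid_H] hom_eps, of \<tau> \<tau>] eps_tau by simp
  finally show ?thesis by (simp add: monoid_hom_def hom_iff antipode_unit)
qed

lemma hom_antipode_id: "monoid_hom B E (l \<otimes> I)"
  by (rule monoid_hom_tensor[OF hom_antipode monoid_hom_id[OF monoid_H]])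

lemma antipode_left: "\<mu>\<^bsub>H\<^esub> \<cdot> \<tau> = \<eta>\<^bsub>H\<^esub> \<cdot> \<epsilon>\<^bsub>H\<^esub>"
  and antipode_right: "(I \<diamondop> l) \<cdot> \<delta>\<^bsub>H\<^esub> = \<eta>\<^bsub>H\<^esub> \<cdot> \<epsilon>\<^bsub>H\<^esub>"
proof -
  have e1: "(I \<otimes> \<epsilon>\<^bsub>H\<^esub>) \<cdot> i1 = I" by (simp add: tensor_comp)
  have e2: "(I \<otimes> \<epsilon>\<^bsub>H\<^esub>) \<cdot> i2 = \<eta>\<^bsub>H\<^esub> \<cdot> \<epsilon>\<^bsub>H\<^esub>"
    using tensor_comp[of "\<one> \<K>" "\<eta>\<^bsub>H\<^esub>" "\<epsilon>\<^bsub>H\<^esub>" "\<one> \<K>"] by (simp add: tensor_comp)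
  have c: "(I \<otimes> \<epsilon>\<^bsub>H\<^esub>) \<cdot> (i1 \<bullet> g) = I \<diamondop> ((I \<otimes> \<epsilon>\<^bsub>H\<^esub>) \<cdot> g)"
    if "g \<in> Arr C" "Cod C g = obj H \<otimes>\<^sub>o obj H" for g
    using counit_conv(1)[OF monoid_H hom_eps, of i1 g] that by (simp add: e1)
  have t: "(I \<otimes> \<epsilon>\<^bsub>H\<^esub>) \<cdot> T = \<mu>\<^bsub>H\<^esub>" "(I \<otimes> \<epsilon>\<^bsub>H\<^esub>) \<cdot> S = I \<diamondop> l"
    using eps_tau by (simp_all add: c mu_eq_conv)
  have "((I \<otimes> \<epsilon>\<^bsub>H\<^esub>) \<cdot> T) \<cdot> \<tau> = (I \<otimes> \<epsilon>\<^bsub>H\<^esub>) \<cdot> (T \<cdot> \<tau>)" by (rule comp_reassoc) simp_all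
  then show "\<mu>\<^bsub>H\<^esub> \<cdot> \<tau> = \<eta>\<^bsub>H\<^esub> \<cdot> \<epsilon>\<^bsub>H\<^esub>" unfolding t T_tau e2 .
  have "((I \<otimes> \<epsilon>\<^bsub>H\<^esub>) \<cdot> S) \<cdot> \<delta>\<^bsub>H\<^esub> = (I \<otimes> \<epsilon>\<^bsub>H\<^esub>) \<cdot> (S \<cdot> \<delta>\<^bsub>H\<^esub>)" by (rule comp_reassoc) simp_all
  then show "(I \<diamondop> l) \<cdot> \<delta>\<^bsub>H\<^esub> = \<eta>\<^bsub>H\<^esub> \<cdot> \<epsilon>\<^bsub>H\<^esub>" unfolding t S_delta e2 .
qed

section \<open>Contractions of threefold tensors\<close>

text \<open>
  For a point \<open>a\<close> of \<open>H\<close>, the maps \<open>\<Phi> a\<close> and \<open>\<Psi> a\<close> contract the first two legs: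
  \<open>x \<otimes> y \<otimes> z \<mapsto> x a \<lambda>(y) \<otimes> z\<close> and \<open>x \<otimes> y \<otimes> z \<mapsto> \<lambda>(x) a y \<otimes> z\<close>. The parameter \<open>a\<close> is
  the result of contracting the factors of a product already dealt with, so that a product of points
  is contracted factor by factor: \<open>\<Phi>\<close> starts with the rightmost factor and \<open>\<Psi>\<close> with the leftmost
  (\<open>\<Phi>_absorb\<close>, \<open>\<Psi>_absorb\<close>).
\<close>

abbreviation H3 where "H3 \<equiv> tensor_monoid C B H"
abbreviation conv_3 (infixr "\<bullet>\<^sub>3" 60) where "f \<bullet>\<^sub>3 g \<equiv> conv C H3 f g"
abbreviation e1 where "e1 \<equiv> I \<otimes> \<eta>\<^bsub>H\<^esub> \<otimes> \<eta>\<^bsub>H\<^esub>"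
abbreviation e2 where "e2 \<equiv> \<eta>\<^bsub>H\<^esub> \<otimes> I \<otimes> \<eta>\<^bsub>H\<^esub>"
abbreviation e3 where "e3 \<equiv> \<eta>\<^bsub>H\<^esub> \<otimes> \<eta>\<^bsub>H\<^esub> \<otimes> I"
abbreviation \<phi> where "\<phi> a \<equiv> I \<diamondop> a \<diamondop> l"
abbreviation \<psi> where "\<psi> a \<equiv> l \<diamondop> a \<diamondop> I"
abbreviation \<Phi> where "\<Phi> a \<equiv> \<phi> a \<otimes> I"
abbreviation \<Psi> where "\<Psi> a \<equiv> \<psi> a \<otimes> I"
abbreviation id3 where "id3 \<equiv> \<one> (obj H \<otimes>\<^sub>o obj H \<otimes>\<^sub>o obj H)"

lemma antipode_mu: "l \<cdot> \<mu>\<^bsub>H\<^esub> = (l \<diamondop> l) \<cdot> sym_arr C (obj H) (obj H)"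
  using hom_antipode by (simp add: monoid_hom_def conv_op)

lemma unit_3 [simp]:
  assumes "f \<in> Arr C" "Cod C f = obj H \<otimes>\<^sub>o obj H \<otimes>\<^sub>o obj H"
  shows "(\<eta>\<^bsub>H\<^esub> \<otimes> \<eta>\<^bsub>H\<^esub> \<otimes> \<eta>\<^bsub>H\<^esub>) \<bullet>\<^sub>3 f = f" "f \<bullet>\<^sub>3 (\<eta>\<^bsub>H\<^esub> \<otimes> \<eta>\<^bsub>H\<^esub> \<otimes> \<eta>\<^bsub>H\<^esub>) = f"
  using conv_unit[of H3 f] assms by simp_all

lemma id3_split: "(e1 \<bullet>\<^sub>3 e2) \<bullet>\<^sub>3 e3 = id3"
  using conv_tensor_point_middle[of B H i1 "\<eta>\<^bsub>H\<^esub>" i2 "\<eta>\<^bsub>H\<^esub>"]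
    conv_tensor_point_middle[of B H "\<one> (obj H \<otimes>\<^sub>o obj H)" "\<eta>\<^bsub>H\<^esub>" "\<eta>\<^bsub>H\<^esub> \<otimes> \<eta>\<^bsub>H\<^esub>" I]
  by (simp add: first_second)

text \<open>
  A left factor from one of the three legs can be taken out of \<open>\<Phi> a\<close>: it becomes a left product in
  \<open>H \<otimes> H\<close> for the outer legs, and, because the antipode reverses products, a product in
  \<open>H\<^sup>o\<^sup>p \<otimes> H\<close> for the middle one. The operations on the right do not involve \<open>a\<close>.
\<close>

lemma \<Phi>_generators:
  assumes a [simp]: "a \<in> Arr C" "Dom C a = \<K>" "Cod C a = obj H"
    and f [simp]: "f \<in> Arr C" "Cod C f = obj H \<otimes>\<^sub>o obj H \<otimes>\<^sub>o obj H"
  shows "\<Phi> a \<cdot> (e1 \<bullet>\<^sub>3 f) = i1 \<bullet> (\<Phi> a \<cdot> f)"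
    and "\<Phi> a \<cdot> (e2 \<bullet>\<^sub>3 f) = (l \<otimes> \<eta>\<^bsub>H\<^esub>) \<odot> (\<Phi> a \<cdot> f)"
    and "\<Phi> a \<cdot> (e3 \<bullet>\<^sub>3 f) = i2 \<bullet> (\<Phi> a \<cdot> f)"
proof -
  let ?id = "\<one> (obj H \<otimes>\<^sub>o obj H)" and ?c = "sym_arr C (obj H) (obj H)"
  have gen: "\<Phi> a \<cdot> (e \<bullet>\<^sub>3 f) = (\<Phi> a \<cdot> (e \<bullet>\<^sub>3 id3)) \<cdot> (I \<otimes> f)"
    if "e \<in> Arr C" "Dom C e = obj H" "Cod C e = obj H \<otimes>\<^sub>o obj H \<otimes>\<^sub>o obj H" for e
    using that conv_comp[of H3 e id3 I f] by simp
  \<comment> \<open>each leg is treated for the identity in place of \<open>f\<close>\<close>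
  have "\<phi> a \<cdot> (i1 \<bullet> ?id) = \<phi> a \<cdot> (\<mu>\<^bsub>H\<^esub> \<otimes> I)" by (simp add: conv_first_left)
  also have "\<dots> = (I \<diamondop> I) \<diamondop> a \<diamondop> l" by (simp add: conv_comp mu_eq_conv)
  also have "\<dots> = I \<diamondop> \<phi> a" by (rule conv_assoc) simp_all
  finally have 1: "\<phi> a \<cdot> (i1 \<bullet> ?id) = I \<diamondop> \<phi> a" .
  have "\<Phi> a \<cdot> (e1 \<bullet>\<^sub>3 id3) = \<Phi> a \<cdot> ((i1 \<bullet> ?id) \<otimes> I)"
    using conv_tensor_point_middle[of B H i1 "\<eta>\<^bsub>H\<^esub>" ?id I] by simp
  also have "\<dots> = (I \<diamondop> \<phi> a) \<otimes> I" by (simp add: tensor_comp 1)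
  also have "\<dots> = i1 \<bullet> \<Phi> a" by (subst conv_tensor_point_middle) simp_all
  finally show "\<Phi> a \<cdot> (e1 \<bullet>\<^sub>3 f) = i1 \<bullet> (\<Phi> a \<cdot> f)"
    by (simp add: gen conv_comp)
  \<comment> \<open>\<open>x a \<lambda>(y y') = x a \<lambda>(y') \<lambda>(y)\<close>, with the symmetries that reorder \<open>y\<close>, \<open>x\<close>, \<open>y'\<close>\<close>
  have "\<phi> a \<cdot> (i2 \<bullet> ?id) = (\<phi> a \<cdot> (I \<otimes> \<mu>\<^bsub>H\<^esub>)) \<cdot> (?c \<otimes> I)"
    using conv_second_left[of H H I I I] by (simp add: mu_eq_conv)
  also have "\<phi> a \<cdot> (I \<otimes> \<mu>\<^bsub>H\<^esub>) = I \<diamondop> ((a \<diamondop> l) \<cdot> \<mu>\<^bsub>H\<^esub>)"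
    by (simp add: conv_comp)
  also have "(a \<diamondop> l) \<cdot> \<mu>\<^bsub>H\<^esub> = a \<diamondop> ((l \<diamondop> l) \<cdot> ?c)"
    using conv_comp[of H a l "\<one> \<K>" "\<mu>\<^bsub>H\<^esub>"] by (simp add: antipode_mu)
  also have "\<dots> = (a \<diamondop> l \<diamondop> l) \<cdot> ?c"
    using conv_comp[of H a "l \<diamondop> l" "\<one> \<K>" ?c] by simp
  also have "I \<diamondop> ((a \<diamondop> l \<diamondop> l) \<cdot> ?c) = (I \<diamondop> a \<diamondop> l \<diamondop> l) \<cdot> (I \<otimes> ?c)"
    by (simp add: conv_comp)
  also have "I \<diamondop> a \<diamondop> l \<diamondop> l = \<phi> a \<diamondop> l" by (simp add: conv_assoc)
  also have "((\<phi> a \<diamondop> l) \<cdot> (I \<otimes> ?c)) \<cdot> (?c \<otimes> I) = l \<star>\<^bsub>op_monoid H\<^esub> \<phi> a"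
    by (simp add: conv_op sym_tensor_right)
  finally have 2: "\<phi> a \<cdot> (i2 \<bullet> ?id) = l \<star>\<^bsub>op_monoid H\<^esub> \<phi> a" .
  have "\<Phi> a \<cdot> (e2 \<bullet>\<^sub>3 id3) = \<Phi> a \<cdot> ((i2 \<bullet> ?id) \<otimes> I)"
    using conv_tensor_point_middle[of B H i2 "\<eta>\<^bsub>H\<^esub>" ?id I] by simp
  also have "\<dots> = (l \<star>\<^bsub>op_monoid H\<^esub> \<phi> a) \<otimes> I" by (simp add: tensor_comp 2)
  also have "\<dots> = (l \<otimes> \<eta>\<^bsub>H\<^esub>) \<odot> \<Phi> a" by (subst conv_tensor_point_middle) simp_all
  finally show "\<Phi> a \<cdot> (e2 \<bullet>\<^sub>3 f) = (l \<otimes> \<eta>\<^bsub>H\<^esub>) \<odot> (\<Phi> a \<cdot> f)"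
    by (simp add: gen conv_comp)
  have "\<Phi> a \<cdot> (e3 \<bullet>\<^sub>3 id3) = (\<Phi> a \<cdot> (?id \<otimes> \<mu>\<^bsub>H\<^esub>)) \<cdot> (sym_arr C (obj H) (obj H \<otimes>\<^sub>o obj H) \<otimes> I)"
    using conv_tensor[of B H "\<eta>\<^bsub>H\<^esub> \<otimes> \<eta>\<^bsub>H\<^esub>" I ?id I] by (simp add: mu_eq_conv)
  also have "\<Phi> a \<cdot> (?id \<otimes> \<mu>\<^bsub>H\<^esub>) = \<phi> a \<otimes> \<mu>\<^bsub>H\<^esub>" by (simp add: tensor_comp)
  also have "(\<phi> a \<otimes> \<mu>\<^bsub>H\<^esub>) \<cdot> (sym_arr C (obj H) (obj H \<otimes>\<^sub>o obj H) \<otimes> I) = i2 \<bullet> \<Phi> a"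
    by (simp add: conv_second_left mu_eq_conv)
  finally show "\<Phi> a \<cdot> (e3 \<bullet>\<^sub>3 f) = i2 \<bullet> (\<Phi> a \<cdot> f)"
    by (simp add: gen conv_comp)
qed

text \<open>
  The mirror image of \<open>\<Phi>_generators\<close>: now right factors are taken out, and the antipode
  reverses the products in the first leg.
\<close>

lemma \<Psi>_generators:
  assumes a [simp]: "a \<in> Arr C" "Dom C a = \<K>" "Cod C a = obj H"
    and f [simp]: "f \<in> Arr C" "Cod C f = obj H \<otimes>\<^sub>o obj H \<otimes>\<^sub>o obj H"
  shows "\<Psi> a \<cdot> (f \<bullet>\<^sub>3 e1) = (\<Psi> a \<cdot> f) \<odot> (l \<otimes> \<eta>\<^bsub>H\<^esub>)"
    and "\<Psi> a \<cdot> (f \<bullet>\<^sub>3 e2) = (\<Psi> a \<cdot> f) \<bullet> i1"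
    and "\<Psi> a \<cdot> (f \<bullet>\<^sub>3 e3) = (\<Psi> a \<cdot> f) \<bullet> i2"
proof -
  let ?id = "\<one> (obj H \<otimes>\<^sub>o obj H)" and ?c = "sym_arr C (obj H) (obj H)"
  have gen: "\<Psi> a \<cdot> (f \<bullet>\<^sub>3 e) = (\<Psi> a \<cdot> (id3 \<bullet>\<^sub>3 e)) \<cdot> (f \<otimes> I)"
    if "e \<in> Arr C" "Dom C e = obj H" "Cod C e = obj H \<otimes>\<^sub>o obj H \<otimes>\<^sub>o obj H" for e
    using that conv_comp[of H3 id3 e f I] by simp
  have "\<psi> a \<cdot> (?id \<bullet> i1) = (\<psi> a \<cdot> (\<mu>\<^bsub>H\<^esub> \<otimes> I)) \<cdot> (I \<otimes> ?c)"
    using conv_tensor[of H H I I I "\<eta>\<^bsub>H\<^esub>"] by (simp add: mu_eq_conv)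
  also have "\<psi> a \<cdot> (\<mu>\<^bsub>H\<^esub> \<otimes> I) = ((l \<diamondop> l) \<cdot> ?c) \<diamondop> a \<diamondop> I"
    by (simp add: conv_comp antipode_mu)
  also have "\<dots> = ((l \<diamondop> l) \<diamondop> a \<diamondop> I) \<cdot> (?c \<otimes> I)" by (simp add: conv_comp)
  also have "(l \<diamondop> l) \<diamondop> a \<diamondop> I = l \<diamondop> \<psi> a" by (rule conv_assoc) simp_all
  also have "((l \<diamondop> \<psi> a) \<cdot> (?c \<otimes> I)) \<cdot> (I \<otimes> ?c) = \<psi> a \<star>\<^bsub>op_monoid H\<^esub> l"
    by (simp add: conv_op sym_tensor_left)
  finally have 1: "\<psi> a \<cdot> (?id \<bullet> i1) = \<psi> a \<star>\<^bsub>op_monoid H\<^esub> l" .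
  have "\<Psi> a \<cdot> (id3 \<bullet>\<^sub>3 e1) = (\<Psi> a \<cdot> ((?id \<bullet> i1) \<otimes> I)) \<cdot> (?id \<otimes> ?c)"
    using conv_tensor[of B H ?id I i1 "\<eta>\<^bsub>H\<^esub>"] by simp
  also have "\<Psi> a \<cdot> ((?id \<bullet> i1) \<otimes> I) = (\<psi> a \<star>\<^bsub>op_monoid H\<^esub> l) \<otimes> I" by (simp add: tensor_comp 1)
  also have "((\<psi> a \<star>\<^bsub>op_monoid H\<^esub> l) \<otimes> I) \<cdot> (?id \<otimes> ?c) = \<Psi> a \<odot> (l \<otimes> \<eta>\<^bsub>H\<^esub>)"
    by (simp add: conv_tensor)
  finally show "\<Psi> a \<cdot> (f \<bullet>\<^sub>3 e1) = (\<Psi> a \<cdot> f) \<odot> (l \<otimes> \<eta>\<^bsub>H\<^esub>)"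
    by (simp add: gen conv_comp)
  have "\<psi> a \<cdot> (?id \<bullet> i2) = \<psi> a \<cdot> (I \<otimes> \<mu>\<^bsub>H\<^esub>)" by (simp add: conv_second_right)
  also have "\<dots> = l \<diamondop> ((a \<diamondop> I) \<cdot> \<mu>\<^bsub>H\<^esub>)" by (simp add: conv_comp)
  also have "(a \<diamondop> I) \<cdot> \<mu>\<^bsub>H\<^esub> = a \<diamondop> I \<diamondop> I"
    using conv_comp[of H a I "\<one> \<K>" "\<mu>\<^bsub>H\<^esub>"] by (simp add: mu_eq_conv)
  also have "l \<diamondop> a \<diamondop> I \<diamondop> I = \<psi> a \<diamondop> I" by (simp add: conv_assoc)
  finally have 2: "\<psi> a \<cdot> (?id \<bullet> i2) = \<psi> a \<diamondop> I" .
  have "\<Psi> a \<cdot> (id3 \<bullet>\<^sub>3 e2) = (\<Psi> a \<cdot> ((?id \<bullet> i2) \<otimes> I)) \<cdot> (?id \<otimes> ?c)"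
    using conv_tensor[of B H ?id I i2 "\<eta>\<^bsub>H\<^esub>"] by simp
  also have "\<Psi> a \<cdot> ((?id \<bullet> i2) \<otimes> I) = (\<psi> a \<diamondop> I) \<otimes> I" by (simp add: tensor_comp 2)
  also have "((\<psi> a \<diamondop> I) \<otimes> I) \<cdot> (?id \<otimes> ?c) = \<Psi> a \<bullet> i1"
    by (simp add: conv_tensor)
  finally show "\<Psi> a \<cdot> (f \<bullet>\<^sub>3 e2) = (\<Psi> a \<cdot> f) \<bullet> i1"
    by (simp add: gen conv_comp)
  have "\<Psi> a \<cdot> (id3 \<bullet>\<^sub>3 e3) = \<Psi> a \<cdot> (?id \<otimes> \<mu>\<^bsub>H\<^esub>)"
    using conv_tensor_point_middle[of B H ?id I "\<eta>\<^bsub>H\<^esub> \<otimes> \<eta>\<^bsub>H\<^esub>" I] by (simp add: mu_eq_conv)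
  also have "\<dots> = \<psi> a \<otimes> \<mu>\<^bsub>H\<^esub>" by (simp add: tensor_comp)
  also have "\<dots> = \<Psi> a \<bullet> i2"
    by (subst conv_tensor_point_middle) (simp_all add: mu_eq_conv)
  finally show "\<Psi> a \<cdot> (f \<bullet>\<^sub>3 e3) = (\<Psi> a \<cdot> f) \<bullet> i2"
    by (simp add: gen conv_comp)
qed

text \<open>
  By \<open>\<Phi>_generators\<close>, the value of \<open>\<Phi> a\<close> at \<open>p \<bullet>\<^sub>3 q\<close> depends on \<open>a\<close> and \<open>q\<close> only
  through \<open>\<Phi> a \<cdot> q\<close>. This equals \<open>\<Phi> b\<close> at the unit, so \<open>a\<close>, \<open>q\<close> may be replaced by
  \<open>b\<close> and the unit.
\<close>

lemma \<Phi>_absorb: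
  assumes a [simp]: "a \<in> Arr C" "Dom C a = \<K>" "Cod C a = obj H"
    and b [simp]: "b \<in> Arr C" "Dom C b = \<K>" "Cod C b = obj H"
    and q [simp]: "q \<in> Arr C" "Dom C q = \<K>" "Cod C q = obj H \<otimes>\<^sub>o obj H \<otimes>\<^sub>o obj H"
    and p [simp]: "p \<in> Arr C" "Cod C p = obj H \<otimes>\<^sub>o obj H \<otimes>\<^sub>o obj H"
    and eq: "\<Phi> a \<cdot> q = b \<otimes> \<eta>\<^bsub>H\<^esub>"
  shows "\<Phi> a \<cdot> (p \<bullet>\<^sub>3 q) = \<Phi> b \<cdot> p"
proof -
  let ?u = "\<eta>\<^bsub>H\<^esub> \<otimes> \<eta>\<^bsub>H\<^esub> \<otimes> \<eta>\<^bsub>H\<^esub>"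
  have split: "id3 \<bullet>\<^sub>3 r = e1 \<bullet>\<^sub>3 (e2 \<bullet>\<^sub>3 (e3 \<bullet>\<^sub>3 r))"
    if "r \<in> Arr C" "Cod C r = obj H \<otimes>\<^sub>o obj H \<otimes>\<^sub>o obj H" for r
    unfolding id3_split[symmetric] using that by (simp add: conv_assoc)
  have unit: "\<Phi> b \<cdot> ?u = b \<otimes> \<eta>\<^bsub>H\<^esub>"
  proof -
    have "\<phi> b \<cdot> (\<eta>\<^bsub>H\<^esub> \<otimes> \<eta>\<^bsub>H\<^esub>) = (I \<cdot> \<eta>\<^bsub>H\<^esub>) \<diamondop> ((b \<diamondop> l) \<cdot> \<eta>\<^bsub>H\<^esub>)"
      by (rule conv_comp) simp_all
    also have "(b \<diamondop> l) \<cdot> \<eta>\<^bsub>H\<^esub> = b"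
      using conv_comp[of H b l "\<one> \<K>" "\<eta>\<^bsub>H\<^esub>"] by (simp add: antipode_unit)
    finally have "\<phi> b \<cdot> (\<eta>\<^bsub>H\<^esub> \<otimes> \<eta>\<^bsub>H\<^esub>) = b" by simp
    then show ?thesis
      using tensor_comp[of "\<eta>\<^bsub>H\<^esub> \<otimes> \<eta>\<^bsub>H\<^esub>" "\<phi> b" "\<eta>\<^bsub>H\<^esub>" I] by simp
  qed
  have expand: "\<Phi> c \<cdot> (id3 \<bullet>\<^sub>3 r) = i1 \<bullet> ((l \<otimes> \<eta>\<^bsub>H\<^esub>) \<odot> (i2 \<bullet> (\<Phi> c \<cdot> r)))"
    if "c \<in> Arr C" "Dom C c = \<K>" "Cod C c = obj H"
      "r \<in> Arr C" "Cod C r = obj H \<otimes>\<^sub>o obj H \<otimes>\<^sub>o obj H" for c r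
    using that by (subst split) (simp_all add: \<Phi>_generators)
  have "\<Phi> a \<cdot> (id3 \<bullet>\<^sub>3 q) = \<Phi> b \<cdot> (id3 \<bullet>\<^sub>3 ?u)"
    using expand[of a q] expand[of b ?u] unfolding eq unit by simp
  also have "\<dots> = \<Phi> b" by simp
  finally have "(\<Phi> a \<cdot> (id3 \<bullet>\<^sub>3 q)) \<cdot> p = \<Phi> b \<cdot> p" by simp
  moreover have "p \<bullet>\<^sub>3 q = (id3 \<bullet>\<^sub>3 q) \<cdot> p"
    using conv_comp[of H3 id3 q p "\<one> \<K>"] by simp
  ultimately show ?thesis by simp
qed

lemma \<Psi>_absorb:
  assumes a [simp]: "a \<in> Arr C" "Dom C a = \<K>" "Cod C a = obj H"
    and b [simp]: "b \<in> Arr C" "Dom C b = \<K>" "Cod C b = obj H"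
    and q [simp]: "q \<in> Arr C" "Dom C q = \<K>" "Cod C q = obj H \<otimes>\<^sub>o obj H \<otimes>\<^sub>o obj H"
    and p [simp]: "p \<in> Arr C" "Cod C p = obj H \<otimes>\<^sub>o obj H \<otimes>\<^sub>o obj H"
    and eq: "\<Psi> a \<cdot> q = b \<otimes> \<eta>\<^bsub>H\<^esub>"
  shows "\<Psi> a \<cdot> (q \<bullet>\<^sub>3 p) = \<Psi> b \<cdot> p"
proof -
  let ?u = "\<eta>\<^bsub>H\<^esub> \<otimes> \<eta>\<^bsub>H\<^esub> \<otimes> \<eta>\<^bsub>H\<^esub>"
  have split: "r \<bullet>\<^sub>3 id3 = ((r \<bullet>\<^sub>3 e1) \<bullet>\<^sub>3 e2) \<bullet>\<^sub>3 e3"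
    if "r \<in> Arr C" "Cod C r = obj H \<otimes>\<^sub>o obj H \<otimes>\<^sub>o obj H" for r
    unfolding id3_split[symmetric] using that by (simp add: conv_assoc)
  have unit: "\<Psi> b \<cdot> ?u = b \<otimes> \<eta>\<^bsub>H\<^esub>"
  proof -
    have "\<psi> b \<cdot> (\<eta>\<^bsub>H\<^esub> \<otimes> \<eta>\<^bsub>H\<^esub>) = (l \<cdot> \<eta>\<^bsub>H\<^esub>) \<diamondop> ((b \<diamondop> I) \<cdot> \<eta>\<^bsub>H\<^esub>)"
      by (rule conv_comp) simp_all
    also have "(b \<diamondop> I) \<cdot> \<eta>\<^bsub>H\<^esub> = b"
      using conv_comp[of H b I "\<one> \<K>" "\<eta>\<^bsub>H\<^esub>"] by simp
    finally have "\<psi> b \<cdot> (\<eta>\<^bsub>H\<^esub> \<otimes> \<eta>\<^bsub>H\<^esub>) = b" by (simp add: antipode_unit)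
    then show ?thesis
      using tensor_comp[of "\<eta>\<^bsub>H\<^esub> \<otimes> \<eta>\<^bsub>H\<^esub>" "\<psi> b" "\<eta>\<^bsub>H\<^esub>" I] by simp
  qed
  have expand: "\<Psi> c \<cdot> (r \<bullet>\<^sub>3 id3) = (((\<Psi> c \<cdot> r) \<odot> (l \<otimes> \<eta>\<^bsub>H\<^esub>)) \<bullet> i1) \<bullet> i2"
    if "c \<in> Arr C" "Dom C c = \<K>" "Cod C c = obj H"
      "r \<in> Arr C" "Cod C r = obj H \<otimes>\<^sub>o obj H \<otimes>\<^sub>o obj H" for c r
    using that by (subst split) (simp_all add: \<Psi>_generators)
  have "\<Psi> a \<cdot> (q \<bullet>\<^sub>3 id3) = \<Psi> b \<cdot> (?u \<bullet>\<^sub>3 id3)"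
    using expand[of a q] expand[of b ?u] unfolding eq unit by simp
  also have "\<dots> = \<Psi> b" by simp
  finally have "(\<Psi> a \<cdot> (q \<bullet>\<^sub>3 id3)) \<cdot> p = \<Psi> b \<cdot> p" by simp
  moreover have "q \<bullet>\<^sub>3 p = (q \<bullet>\<^sub>3 id3) \<cdot> p"
    using conv_comp[of H3 q id3 "\<one> \<K>" p] by simp
  ultimately show ?thesis by simp
qed

end

section \<open>Contracting the twist equation\<close>

locale twisted_left_Hopf = left_Hopf C H l
  for C :: "('o, 'm) smcat" (structure) and H l +
  fixes J :: 'm
  assumes twist: "twist C H J" and conormal: "conormal C H J"
begin

text \<open>
  In Sweedler notation, \<open>v = F\<^sub>1 \<lambda>(F\<^sub>2)\<close> and \<open>w = \<lambda>(J\<^sub>1) J\<^sub>2\<close>; the latter will be the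
  convolution inverse of the former.
\<close>

definition F where "F = twist_inv C H J"
definition v where "v = \<mu>\<^bsub>H\<^esub> \<cdot> (I \<otimes> l) \<cdot> F"
definition w where "w = \<mu>\<^bsub>H\<^esub> \<cdot> (l \<otimes> I) \<cdot> J"

lemma twist_inverse: "conv_inverse_of C B J F"
  using twist conv_inv_eq[of B J] by (auto simp: twist_def F_def twist_inv_def)

lemma twist_arr [simp]:
  "J \<in> Arr C" "Dom C J = \<K>" "Cod C J = obj H \<otimes>\<^sub>o obj H"
  "F \<in> Arr C" "Dom C F = \<K>" "Cod C F = obj H \<otimes>\<^sub>o obj H"
  using twist_inverse by (auto simp: conv_inverse_of_def hom_iff)

lemma J_F: "J \<bullet> F = \<eta>\<^bsub>H\<^esub> \<otimes> \<eta>\<^bsub>H\<^esub>" and F_J: "F \<bullet> J = \<eta>\<^bsub>H\<^esub> \<otimes> \<eta>\<^bsub>H\<^esub>"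
  using twist_inverse by (auto simp: conv_inverse_of_def)

lemma vw_arr [simp]:
  "v \<in> Arr C" "Dom C v = \<K>" "Cod C v = obj H" "w \<in> Arr C" "Dom C w = \<K>" "Cod C w = obj H"
  by (simp_all add: v_def w_def)

lemma conormal_J: "(\<epsilon>\<^bsub>H\<^esub> \<otimes> I) \<cdot> J = \<eta>\<^bsub>H\<^esub>" "(I \<otimes> \<epsilon>\<^bsub>H\<^esub>) \<cdot> J = \<eta>\<^bsub>H\<^esub>"
  using conormal by (auto simp: conormal_def)

lemma conormal_F: "(\<epsilon>\<^bsub>H\<^esub> \<otimes> I) \<cdot> F = \<eta>\<^bsub>H\<^esub>" "(I \<otimes> \<epsilon>\<^bsub>H\<^esub>) \<cdot> F = \<eta>\<^bsub>H\<^esub>"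
proof -
  have "(\<epsilon>\<^bsub>H\<^esub> \<otimes> I) \<cdot> F = (\<epsilon>\<^bsub>H\<^esub> \<otimes> I) \<cdot> (J \<bullet> F)" "(I \<otimes> \<epsilon>\<^bsub>H\<^esub>) \<cdot> F = (I \<otimes> \<epsilon>\<^bsub>H\<^esub>) \<cdot> (J \<bullet> F)"
    by (simp_all add: counit_conv[OF monoid_H hom_eps] conormal_J)
  then show "(\<epsilon>\<^bsub>H\<^esub> \<otimes> I) \<cdot> F = \<eta>\<^bsub>H\<^esub>" "(I \<otimes> \<epsilon>\<^bsub>H\<^esub>) \<cdot> F = \<eta>\<^bsub>H\<^esub>"
    by (simp_all add: J_F tensor_comp)
qed

lemma hom_delta_first: "monoid_hom B H3 (\<delta>\<^bsub>H\<^esub> \<otimes> I)"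
  by (rule monoid_hom_tensor[OF hom_delta monoid_hom_id[OF monoid_H]])

lemma hom_delta_second: "monoid_hom B H3 (I \<otimes> \<delta>\<^bsub>H\<^esub>)"
  using monoid_hom_tensor[OF monoid_hom_id[OF monoid_H] hom_delta]
  by (simp add: tensor_monoid_assoc)

lemma leg_inverse:
  "(\<eta>\<^bsub>H\<^esub> \<otimes> J) \<bullet>\<^sub>3 (\<eta>\<^bsub>H\<^esub> \<otimes> F) = \<eta>\<^bsub>H\<^esub> \<otimes> \<eta>\<^bsub>H\<^esub> \<otimes> \<eta>\<^bsub>H\<^esub>"
  "(J \<otimes> \<eta>\<^bsub>H\<^esub>) \<bullet>\<^sub>3 (F \<otimes> \<eta>\<^bsub>H\<^esub>) = \<eta>\<^bsub>H\<^esub> \<otimes> \<eta>\<^bsub>H\<^esub> \<otimes> \<eta>\<^bsub>H\<^esub>"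
  using conv_tensor_point_middle[of H B "\<eta>\<^bsub>H\<^esub>" J "\<eta>\<^bsub>H\<^esub>" F]
    conv_tensor_point_middle[of B H J "\<eta>\<^bsub>H\<^esub>" F "\<eta>\<^bsub>H\<^esub>"]
  by (simp_all add: tensor_monoid_assoc J_F)

lemma twist_eq:
  "((\<delta>\<^bsub>H\<^esub> \<otimes> I) \<cdot> J) \<bullet>\<^sub>3 (J \<otimes> \<eta>\<^bsub>H\<^esub>) = ((I \<otimes> \<delta>\<^bsub>H\<^esub>) \<cdot> J) \<bullet>\<^sub>3 (\<eta>\<^bsub>H\<^esub> \<otimes> J)"
  using twist by (simp add: twist_def)

text \<open>
  The twist equation is solved for \<open>1 \<otimes> \<delta>\<close> at \<open>J\<close> and at \<open>J\<inverse>\<close>, because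
  \<open>T \<cdot> (\<lambda> \<otimes> 1)\<close> and \<open>S\<close> are the contractions of \<open>1 \<otimes> \<delta>\<close> by \<open>\<Psi>\<close> and \<open>\<Phi>\<close>.
\<close>

lemma delta_second_J:
  "(I \<otimes> \<delta>\<^bsub>H\<^esub>) \<cdot> J = ((\<delta>\<^bsub>H\<^esub> \<otimes> I) \<cdot> J) \<bullet>\<^sub>3 (J \<otimes> \<eta>\<^bsub>H\<^esub>) \<bullet>\<^sub>3 (\<eta>\<^bsub>H\<^esub> \<otimes> F)"
proof -
  have "((\<delta>\<^bsub>H\<^esub> \<otimes> I) \<cdot> J) \<bullet>\<^sub>3 (J \<otimes> \<eta>\<^bsub>H\<^esub>) \<bullet>\<^sub>3 (\<eta>\<^bsub>H\<^esub> \<otimes> F)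
    = (((\<delta>\<^bsub>H\<^esub> \<otimes> I) \<cdot> J) \<bullet>\<^sub>3 (J \<otimes> \<eta>\<^bsub>H\<^esub>)) \<bullet>\<^sub>3 (\<eta>\<^bsub>H\<^esub> \<otimes> F)"
    by (rule conv_assoc[symmetric]) simp_all
  also have "\<dots> = ((I \<otimes> \<delta>\<^bsub>H\<^esub>) \<cdot> J) \<bullet>\<^sub>3 ((\<eta>\<^bsub>H\<^esub> \<otimes> J) \<bullet>\<^sub>3 (\<eta>\<^bsub>H\<^esub> \<otimes> F))"
    unfolding twist_eq by (rule conv_assoc) simp_all
  finally show ?thesis by (simp add: leg_inverse)
qed

lemma delta_second_F:
  "(I \<otimes> \<delta>\<^bsub>H\<^esub>) \<cdot> F = ((\<eta>\<^bsub>H\<^esub> \<otimes> J) \<bullet>\<^sub>3 (F \<otimes> \<eta>\<^bsub>H\<^esub>)) \<bullet>\<^sub>3 ((\<delta>\<^bsub>H\<^esub> \<otimes> I) \<cdot> F)"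
proof -
  let ?u = "\<eta>\<^bsub>H\<^esub> \<otimes> \<eta>\<^bsub>H\<^esub> \<otimes> \<eta>\<^bsub>H\<^esub>"
  let ?D1 = "\<delta>\<^bsub>H\<^esub> \<otimes> I" and ?D2 = "I \<otimes> \<delta>\<^bsub>H\<^esub>"
  let ?X = "((\<eta>\<^bsub>H\<^esub> \<otimes> J) \<bullet>\<^sub>3 (F \<otimes> \<eta>\<^bsub>H\<^esub>)) \<bullet>\<^sub>3 (?D1 \<cdot> F)"
  have D1: "(?D1 \<cdot> J) \<bullet>\<^sub>3 (?D1 \<cdot> F) = ?u"
    using monoid_hom_conv[OF hom_delta_first, of J F] by (simp add: J_F tensor_comp)
  have D2: "(?D2 \<cdot> F) \<bullet>\<^sub>3 (?D2 \<cdot> J) = ?u"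
    using monoid_hom_conv[OF hom_delta_second, of F J] by (simp add: F_J tensor_comp)
  have "(?D2 \<cdot> J) \<bullet>\<^sub>3 ?X = (((?D2 \<cdot> J) \<bullet>\<^sub>3 (\<eta>\<^bsub>H\<^esub> \<otimes> J)) \<bullet>\<^sub>3 (F \<otimes> \<eta>\<^bsub>H\<^esub>)) \<bullet>\<^sub>3 (?D1 \<cdot> F)"
    by (simp add: conv_assoc)
  also have "\<dots> = ((?D1 \<cdot> J) \<bullet>\<^sub>3 ((J \<otimes> \<eta>\<^bsub>H\<^esub>) \<bullet>\<^sub>3 (F \<otimes> \<eta>\<^bsub>H\<^esub>))) \<bullet>\<^sub>3 (?D1 \<cdot> F)"
    unfolding twist_eq[symmetric] by (simp add: conv_assoc)
  also have "\<dots> = ?u" by (simp add: leg_inverse D1)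
  finally have X: "(?D2 \<cdot> J) \<bullet>\<^sub>3 ?X = ?u" .
  \<comment> \<open>\<open>X\<close> and \<open>(1 \<otimes> \<delta>)(F)\<close> are a right and a left inverse of the same point\<close>
  have "?D2 \<cdot> F = (?D2 \<cdot> F) \<bullet>\<^sub>3 ((?D2 \<cdot> J) \<bullet>\<^sub>3 ?X)" unfolding X by simp
  also have "\<dots> = ((?D2 \<cdot> F) \<bullet>\<^sub>3 (?D2 \<cdot> J)) \<bullet>\<^sub>3 ?X" by (rule conv_assoc[symmetric]) simp_all
  also have "\<dots> = ?X" unfolding D2 by simp
  finally show ?thesis .
qed

definition J_hat where "J_hat = (l \<otimes> I) \<cdot> J"
definition F_hat where "F_hat = (l \<otimes> I) \<cdot> F"

lemma hat_arr [simp]: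
  "J_hat \<in> Arr C" "Dom C J_hat = \<K>" "Cod C J_hat = obj H \<otimes>\<^sub>o obj H"
  "F_hat \<in> Arr C" "Dom C F_hat = \<K>" "Cod C F_hat = obj H \<otimes>\<^sub>o obj H"
  by (simp_all add: J_hat_def F_hat_def)

text \<open>
  \<open>\<lambda> \<otimes> 1\<close> is a morphism of monoids from \<open>H \<otimes> H\<close> to \<open>H\<^sup>o\<^sup>p \<otimes> H\<close>.
\<close>

lemma hat_inverse: "J_hat \<odot> F_hat = \<eta>\<^bsub>H\<^esub> \<otimes> \<eta>\<^bsub>H\<^esub>" "F_hat \<odot> J_hat = \<eta>\<^bsub>H\<^esub> \<otimes> \<eta>\<^bsub>H\<^esub>"
proof -
  have "J_hat \<odot> F_hat = (l \<otimes> I) \<cdot> (J \<bullet> F)" "F_hat \<odot> J_hat = (l \<otimes> I) \<cdot> (F \<bullet> J)"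
    by (simp_all add: monoid_hom_conv[OF hom_antipode_id] J_hat_def F_hat_def)
  then show "J_hat \<odot> F_hat = \<eta>\<^bsub>H\<^esub> \<otimes> \<eta>\<^bsub>H\<^esub>" "F_hat \<odot> J_hat = \<eta>\<^bsub>H\<^esub> \<otimes> \<eta>\<^bsub>H\<^esub>"
    by (simp_all add: J_F F_J tensor_comp antipode_unit)
qed

lemma counit_unit_first:
  assumes "X \<in> Arr C" "Dom C X = \<K>" "Cod C X = obj H \<otimes>\<^sub>o obj H" "(\<epsilon>\<^bsub>H\<^esub> \<otimes> I) \<cdot> X = \<eta>\<^bsub>H\<^esub>"
  shows "((\<eta>\<^bsub>H\<^esub> \<cdot> \<epsilon>\<^bsub>H\<^esub>) \<otimes> I) \<cdot> X = \<eta>\<^bsub>H\<^esub> \<otimes> \<eta>\<^bsub>H\<^esub>"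
proof -
  have "(\<eta>\<^bsub>H\<^esub> \<cdot> \<epsilon>\<^bsub>H\<^esub>) \<otimes> I = i2 \<cdot> (\<epsilon>\<^bsub>H\<^esub> \<otimes> I)"
    using tensor_comp[of "\<epsilon>\<^bsub>H\<^esub>" "\<eta>\<^bsub>H\<^esub>" I I] by simp
  then have "((\<eta>\<^bsub>H\<^esub> \<cdot> \<epsilon>\<^bsub>H\<^esub>) \<otimes> I) \<cdot> X = i2 \<cdot> (\<epsilon>\<^bsub>H\<^esub> \<otimes> I) \<cdot> X"
    using assms by simp
  then show ?thesis unfolding assms(4) by (simp add: second_comp)
qed

text \<open>
  \<open>T(\<lambda>(J\<^sub>1) \<otimes> J\<^sub>2)\<close> is the contraction by \<open>\<Psi>\<close> of \<open>(1 \<otimes> \<delta>)(J)\<close>, which is a product of three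
  points. The first, \<open>(\<delta> \<otimes> 1)(J)\<close>, contracts to the unit by the antipode and conormality; the
  second, \<open>J \<otimes> 1\<close>, contracts to \<open>w\<close>; the third, \<open>1 \<otimes> J\<inverse>\<close>, is then multiplied by \<open>w\<close>.
\<close>

lemma T_J_hat: "T \<cdot> J_hat = (w \<otimes> \<eta>\<^bsub>H\<^esub>) \<bullet> F"
proof -
  have \<psi>u: "\<psi> \<eta>\<^bsub>H\<^esub> = \<mu>\<^bsub>H\<^esub> \<cdot> (l \<otimes> I)" by (simp add: conv_def[of C H l I, symmetric])
  have \<Psi>u: "\<Psi> \<eta>\<^bsub>H\<^esub> = (\<mu>\<^bsub>H\<^esub> \<otimes> I) \<cdot> (l \<otimes> I \<otimes> I)"
    unfolding \<psi>u using tensor_comp[of "l \<otimes> I" "\<mu>\<^bsub>H\<^esub>" I I] by simp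
  have D: "\<Psi> \<eta>\<^bsub>H\<^esub> \<cdot> ((\<delta>\<^bsub>H\<^esub> \<otimes> I) \<cdot> J) = \<eta>\<^bsub>H\<^esub> \<otimes> \<eta>\<^bsub>H\<^esub>"
  proof -
    have "\<Psi> \<eta>\<^bsub>H\<^esub> \<cdot> ((\<delta>\<^bsub>H\<^esub> \<otimes> I) \<cdot> J) = ((\<mu>\<^bsub>H\<^esub> \<cdot> \<tau>) \<otimes> I) \<cdot> J"
      unfolding \<psi>u by (simp add: tensor_comp_assoc)
    then show ?thesis unfolding antipode_left using counit_unit_first[of J] by (simp add: conormal_J)
  qed
  have W: "\<Psi> \<eta>\<^bsub>H\<^esub> \<cdot> (J \<otimes> \<eta>\<^bsub>H\<^esub>) = w \<otimes> \<eta>\<^bsub>H\<^esub>"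
    unfolding \<psi>u w_def using tensor_comp[of J "\<mu>\<^bsub>H\<^esub> \<cdot> (l \<otimes> I)" "\<eta>\<^bsub>H\<^esub>" I] by simp
  have "\<psi> w \<cdot> i2 = (l \<cdot> \<eta>\<^bsub>H\<^esub>) \<diamondop> ((w \<diamondop> I) \<cdot> I)"
    by (rule conv_comp) simp_all
  then have \<psi>w: "\<psi> w \<cdot> i2 = w \<diamondop> I" unfolding antipode_unit by simp
  have "\<Psi> w \<cdot> (\<eta>\<^bsub>H\<^esub> \<otimes> F) = ((w \<diamondop> I) \<otimes> I) \<cdot> F"
  proof -
    have "\<eta>\<^bsub>H\<^esub> \<otimes> F = (i2 \<otimes> I) \<cdot> F"
      using tensor_comp[of "\<one> \<K>" "\<eta>\<^bsub>H\<^esub>" F "\<one> (obj H \<otimes>\<^sub>o obj H)"] by simp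
    then have "\<Psi> w \<cdot> (\<eta>\<^bsub>H\<^esub> \<otimes> F) = (\<Psi> w \<cdot> (i2 \<otimes> I)) \<cdot> F" by simp
    also have "\<Psi> w \<cdot> (i2 \<otimes> I) = (w \<diamondop> I) \<otimes> I"
      by (subst tensor_comp) (simp_all add: \<psi>w)
    finally show ?thesis .
  qed
  also have "(w \<diamondop> I) \<otimes> I = (w \<otimes> \<eta>\<^bsub>H\<^esub>) \<bullet> (I \<otimes> I)"
    by (subst conv_tensor_point_middle) simp_all
  also have "\<dots> \<cdot> F = (w \<otimes> \<eta>\<^bsub>H\<^esub>) \<bullet> F"
    using conv_comp[of B "w \<otimes> \<eta>\<^bsub>H\<^esub>" "I \<otimes> I" "\<one> \<K>" F] by simp
  finally have R: "\<Psi> w \<cdot> (\<eta>\<^bsub>H\<^esub> \<otimes> F) = (w \<otimes> \<eta>\<^bsub>H\<^esub>) \<bullet> F" .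
  have "T \<cdot> J_hat = \<Psi> \<eta>\<^bsub>H\<^esub> \<cdot> ((I \<otimes> \<delta>\<^bsub>H\<^esub>) \<cdot> J)"
    unfolding \<Psi>u J_hat_def by (simp add: lin_alt tensor_comp_assoc)
  also have "\<dots> = \<Psi> \<eta>\<^bsub>H\<^esub> \<cdot> ((J \<otimes> \<eta>\<^bsub>H\<^esub>) \<bullet>\<^sub>3 (\<eta>\<^bsub>H\<^esub> \<otimes> F))"
    unfolding delta_second_J by (rule \<Psi>_absorb[OF _ _ _ _ _ _ _ _ _ _ _ D]) simp_all
  also have "\<dots> = \<Psi> w \<cdot> (\<eta>\<^bsub>H\<^esub> \<otimes> F)"
    by (rule \<Psi>_absorb[OF _ _ _ _ _ _ _ _ _ _ _ W]) simp_all
  finally show ?thesis unfolding R .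
qed

text \<open>
  Contracting \<open>(1 \<otimes> \<delta>)(J\<inverse>)\<close> by \<open>\<Phi>\<close>, the rightmost factor \<open>(\<delta> \<otimes> 1)(J\<inverse>)\<close> becomes trivial,
  \<open>J\<inverse> \<otimes> 1\<close> becomes \<open>v\<close>, and \<open>1 \<otimes> J\<close> becomes \<open>v \<lambda>(J\<^sub>1) \<otimes> J\<^sub>2\<close>.
\<close>

lemma S_F: "S \<cdot> F = (v \<otimes> \<eta>\<^bsub>H\<^esub>) \<bullet> J_hat"
proof -
  have \<phi>u: "\<phi> \<eta>\<^bsub>H\<^esub> = \<mu>\<^bsub>H\<^esub> \<cdot> (I \<otimes> l)" by (simp add: conv_def[of C H I l, symmetric])
  have \<Phi>u: "\<Phi> \<eta>\<^bsub>H\<^esub> = (\<mu>\<^bsub>H\<^esub> \<otimes> I) \<cdot> (I \<otimes> l \<otimes> I)"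
    unfolding \<phi>u using tensor_comp[of "I \<otimes> l" "\<mu>\<^bsub>H\<^esub>" I I] by simp
  have D: "\<Phi> \<eta>\<^bsub>H\<^esub> \<cdot> ((\<delta>\<^bsub>H\<^esub> \<otimes> I) \<cdot> F) = \<eta>\<^bsub>H\<^esub> \<otimes> \<eta>\<^bsub>H\<^esub>"
  proof -
    have "\<Phi> \<eta>\<^bsub>H\<^esub> \<cdot> ((\<delta>\<^bsub>H\<^esub> \<otimes> I) \<cdot> F) = (((I \<diamondop> l) \<cdot> \<delta>\<^bsub>H\<^esub>) \<otimes> I) \<cdot> F"
      by (simp add: tensor_comp_assoc)
    then show ?thesis unfolding antipode_right using counit_unit_first[of F] by (simp add: conormal_F)
  qed
  have W: "\<Phi> \<eta>\<^bsub>H\<^esub> \<cdot> (F \<otimes> \<eta>\<^bsub>H\<^esub>) = v \<otimes> \<eta>\<^bsub>H\<^esub>"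
    unfolding \<phi>u v_def using tensor_comp[of F "\<mu>\<^bsub>H\<^esub> \<cdot> (I \<otimes> l)" "\<eta>\<^bsub>H\<^esub>" I] by simp
  have \<phi>v: "\<phi> v \<cdot> i2 = v \<diamondop> l"
    using conv_comp[of H I "v \<diamondop> l" "\<eta>\<^bsub>H\<^esub>" I] by simp
  have "\<Phi> v \<cdot> (\<eta>\<^bsub>H\<^esub> \<otimes> J) = ((v \<diamondop> l) \<otimes> I) \<cdot> J"
  proof -
    have "\<eta>\<^bsub>H\<^esub> \<otimes> J = (i2 \<otimes> I) \<cdot> J"
      using tensor_comp[of "\<one> \<K>" "\<eta>\<^bsub>H\<^esub>" J "\<one> (obj H \<otimes>\<^sub>o obj H)"] by simp
    then have "\<Phi> v \<cdot> (\<eta>\<^bsub>H\<^esub> \<otimes> J) = (\<Phi> v \<cdot> (i2 \<otimes> I)) \<cdot> J" by simp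
    also have "\<Phi> v \<cdot> (i2 \<otimes> I) = (v \<diamondop> l) \<otimes> I"
      by (subst tensor_comp) (simp_all add: \<phi>v)
    finally show ?thesis .
  qed
  also have "(v \<diamondop> l) \<otimes> I = (v \<otimes> \<eta>\<^bsub>H\<^esub>) \<bullet> (l \<otimes> I)"
    by (subst conv_tensor_point_middle) simp_all
  also have "\<dots> \<cdot> J = (v \<otimes> \<eta>\<^bsub>H\<^esub>) \<bullet> J_hat"
    unfolding J_hat_def using conv_comp[of B "v \<otimes> \<eta>\<^bsub>H\<^esub>" "l \<otimes> I" "\<one> \<K>" J] by simp
  finally have R: "\<Phi> v \<cdot> (\<eta>\<^bsub>H\<^esub> \<otimes> J) = (v \<otimes> \<eta>\<^bsub>H\<^esub>) \<bullet> J_hat" .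
  have "S \<cdot> F = \<Phi> \<eta>\<^bsub>H\<^esub> \<cdot> ((I \<otimes> \<delta>\<^bsub>H\<^esub>) \<cdot> F)"
  proof -
    have "I \<otimes> \<tau> = (I \<otimes> l \<otimes> I) \<cdot> (I \<otimes> \<delta>\<^bsub>H\<^esub>)"
      using tensor_comp[of I I "\<delta>\<^bsub>H\<^esub>" "l \<otimes> I"] by simp
    then show ?thesis unfolding \<Phi>u by (simp add: lin_alt)
  qed
  also have "\<dots> = \<Phi> \<eta>\<^bsub>H\<^esub> \<cdot> ((\<eta>\<^bsub>H\<^esub> \<otimes> J) \<bullet>\<^sub>3 (F \<otimes> \<eta>\<^bsub>H\<^esub>))"
    unfolding delta_second_F by (rule \<Phi>_absorb[OF _ _ _ _ _ _ _ _ _ _ _ D]) simp_all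
  also have "\<dots> = \<Phi> v \<cdot> (\<eta>\<^bsub>H\<^esub> \<otimes> J)"
    by (rule \<Phi>_absorb[OF _ _ _ _ _ _ _ _ _ _ _ W]) simp_all
  finally show ?thesis unfolding R .
qed

lemma eps_second:
  assumes "a \<in> Arr C" "Cod C a = obj H" "X \<in> Arr C" "Cod C X = obj H \<otimes>\<^sub>o obj H"
  shows "(I \<otimes> \<epsilon>\<^bsub>H\<^esub>) \<cdot> ((a \<otimes> \<eta>\<^bsub>H\<^esub>) \<bullet> X) = a \<diamondop> ((I \<otimes> \<epsilon>\<^bsub>H\<^esub>) \<cdot> X)"
  using counit_conv(1)[OF monoid_H hom_eps, of "a \<otimes> \<eta>\<^bsub>H\<^esub>" X] assms by (simp add: tensor_comp)

lemma T_v_J_hat: "T \<cdot> ((v \<otimes> \<eta>\<^bsub>H\<^esub>) \<bullet> J_hat) = F"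
proof -
  have "T \<cdot> (S \<cdot> F) = (T \<cdot> S) \<cdot> F" by (subst comp_reassoc) simp_all
  then show ?thesis unfolding S_F T_S by simp
qed

text \<open>
  \<open>T_v_J_hat\<close> and \<open>T_J_hat\<close> give \<open>F = (v w \<otimes> 1) F\<close>, and the counit on the second leg sends
  \<open>F\<close> to the unit.
\<close>

lemma v_w: "v \<diamondop> w = \<eta>\<^bsub>H\<^esub>"
proof -
  have *: "(v \<otimes> \<eta>\<^bsub>H\<^esub>) \<bullet> ((w \<otimes> \<eta>\<^bsub>H\<^esub>) \<bullet> F) = F"
    using T_v_J_hat by (simp add: lin_linear T_J_hat)
  have "(I \<otimes> \<epsilon>\<^bsub>H\<^esub>) \<cdot> F = v \<diamondop> w \<diamondop> ((I \<otimes> \<epsilon>\<^bsub>H\<^esub>) \<cdot> F)"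
    using eps_second[of v "(w \<otimes> \<eta>\<^bsub>H\<^esub>) \<bullet> F"] eps_second[of w F] by (simp add: *)
  then show ?thesis by (simp add: conormal_F)
qed

text \<open>
  \<open>T_J_hat\<close> and \<open>S_F\<close> give \<open>\<lambda>(J\<^sub>1) \<otimes> J\<^sub>2 = w v \<lambda>(J\<^sub>1) \<otimes> J\<^sub>2\<close>; apply the counit to the second leg.
\<close>

lemma w_v: "w \<diamondop> v = \<eta>\<^bsub>H\<^esub>"
proof -
  have "S \<cdot> ((w \<otimes> \<eta>\<^bsub>H\<^esub>) \<bullet> F) = J_hat"
    by (rule S_eqI[OF _ _ _ _ T_J_hat]) simp_all
  moreover have "S \<cdot> ((w \<otimes> \<eta>\<^bsub>H\<^esub>) \<bullet> F) = (w \<otimes> \<eta>\<^bsub>H\<^esub>) \<bullet> (S \<cdot> F)"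
    by (rule lin_linear) simp_all
  ultimately have *: "(w \<otimes> \<eta>\<^bsub>H\<^esub>) \<bullet> ((v \<otimes> \<eta>\<^bsub>H\<^esub>) \<bullet> J_hat) = J_hat" by (simp add: S_F)
  have "(I \<otimes> \<epsilon>\<^bsub>H\<^esub>) \<cdot> J_hat = w \<diamondop> v \<diamondop> ((I \<otimes> \<epsilon>\<^bsub>H\<^esub>) \<cdot> J_hat)"
    using eps_second[of w "(v \<otimes> \<eta>\<^bsub>H\<^esub>) \<bullet> J_hat"] eps_second[of v J_hat] by (simp add: *)
  moreover have "(I \<otimes> \<epsilon>\<^bsub>H\<^esub>) \<cdot> J_hat = \<eta>\<^bsub>H\<^esub>"
  proof -
    have "(I \<otimes> \<epsilon>\<^bsub>H\<^esub>) \<cdot> (l \<otimes> I) = l \<cdot> (I \<otimes> \<epsilon>\<^bsub>H\<^esub>)"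
      using tensor_comp[of I l "\<epsilon>\<^bsub>H\<^esub>" "\<one> \<K>"] by (simp add: tensor_comp)
    then have "(I \<otimes> \<epsilon>\<^bsub>H\<^esub>) \<cdot> J_hat = l \<cdot> (I \<otimes> \<epsilon>\<^bsub>H\<^esub>) \<cdot> J"
      unfolding J_hat_def by (simp flip: comp_reassoc)
    then show ?thesis by (simp add: conormal_J antipode_unit)
  qed
  ultimately show ?thesis by simp
qed

section \<open>The deformed antipode\<close>

text \<open>
  \<open>W = v \<lambda>(J\<^sub>1) \<otimes> J\<^sub>2\<close> and \<open>U = \<lambda>(F\<^sub>1) w \<otimes> F\<^sub>2\<close>.
\<close>

definition W where "W = J_hat \<odot> (v \<otimes> \<eta>\<^bsub>H\<^esub>)"
definition U where "U = (w \<otimes> \<eta>\<^bsub>H\<^esub>) \<odot> F_hat"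

lemma WU_arr [simp]:
  "W \<in> Arr C" "Dom C W = \<K>" "Cod C W = obj H \<otimes>\<^sub>o obj H"
  "U \<in> Arr C" "Dom C U = \<K>" "Cod C U = obj H \<otimes>\<^sub>o obj H"
  by (simp_all add: W_def U_def)

lemma W_as_left_product: "W = (v \<otimes> \<eta>\<^bsub>H\<^esub>) \<bullet> J_hat"
  by (simp add: W_def conv_op_tensor_first)

lemma T_W: "T \<cdot> W = F"
  by (simp add: W_as_left_product T_v_J_hat)

lemma op_first_mult:
  assumes "a \<in> Arr C" "Dom C a = \<K>" "Cod C a = obj H" "b \<in> Arr C" "Dom C b = \<K>" "Cod C b = obj H"
  shows "(a \<otimes> \<eta>\<^bsub>H\<^esub>) \<odot> (b \<otimes> \<eta>\<^bsub>H\<^esub>) = (b \<diamondop> a) \<otimes> \<eta>\<^bsub>H\<^esub>"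
  using assms by (simp add: conv_op_tensor_first first_mult)

lemma U_W: "U \<odot> W = \<eta>\<^bsub>H\<^esub> \<otimes> \<eta>\<^bsub>H\<^esub>"
proof -
  have "U \<odot> W = (w \<otimes> \<eta>\<^bsub>H\<^esub>) \<odot> ((F_hat \<odot> J_hat) \<odot> (v \<otimes> \<eta>\<^bsub>H\<^esub>))"
    by (simp add: U_def W_def conv_assoc)
  then show ?thesis by (simp add: hat_inverse op_first_mult v_w)
qed

lemma W_U: "W \<odot> U = \<eta>\<^bsub>H\<^esub> \<otimes> \<eta>\<^bsub>H\<^esub>"
proof -
  have "W \<odot> U = J_hat \<odot> (((v \<otimes> \<eta>\<^bsub>H\<^esub>) \<odot> (w \<otimes> \<eta>\<^bsub>H\<^esub>)) \<odot> F_hat)"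
    by (simp add: U_def W_def conv_assoc)
  then show ?thesis by (simp add: hat_inverse op_first_mult w_v)
qed

definition delta_J where "delta_J = F \<bullet> \<delta>\<^bsub>H\<^esub> \<bullet> J"
definition antipode_J where "antipode_J = v \<diamondop> l \<diamondop> w"

lemma deformed_arr [simp]:
  "delta_J \<in> Arr C" "Dom C delta_J = obj H" "Cod C delta_J = obj H \<otimes>\<^sub>o obj H"
  "antipode_J \<in> Arr C" "Dom C antipode_J = obj H" "Cod C antipode_J = obj H"
  by (simp_all add: delta_J_def antipode_J_def)

lemma twist_deformation_eq: "twist_deformation C H J = H\<lparr>delta := delta_J\<rparr>"
proof -
  have "delta_J = (F \<bullet> \<delta>\<^bsub>H\<^esub>) \<bullet> J" unfolding delta_J_def by (rule conv_assoc[symmetric]) simp_all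
  also have "\<dots> = \<mu>\<^bsub>B\<^esub> \<cdot> (\<mu>\<^bsub>B\<^esub> \<otimes> \<one> (obj H \<otimes>\<^sub>o obj H)) \<cdot> ((F \<otimes> \<delta>\<^bsub>H\<^esub>) \<otimes> J)"
    unfolding conv_def by (subst tensor_comp) (simp_all del: tensor_arr_assoc)
  finally show ?thesis
    by (simp add: twist_deformation_def F_def[symmetric])
qed

text \<open>
  \<open>\<lambda> \<otimes> 1\<close> turns the product \<open>J\<inverse> \<delta>(h) J\<close> into a product for \<open>\<odot>\<close>; the factors \<open>v\<close> and \<open>w\<close> of the
  deformed antipode complete its two outer factors to \<open>W\<close> and \<open>U\<close>.
\<close>

lemma tau_deformed: "(antipode_J \<otimes> I) \<cdot> delta_J = U \<odot> \<tau> \<odot> W"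
proof -
  have "(l \<otimes> I) \<cdot> delta_J = F_hat \<odot> ((l \<otimes> I) \<cdot> (\<delta>\<^bsub>H\<^esub> \<bullet> J))"
    unfolding delta_J_def F_hat_def by (rule monoid_hom_conv[OF hom_antipode_id]) simp_all
  also have "(l \<otimes> I) \<cdot> (\<delta>\<^bsub>H\<^esub> \<bullet> J) = \<tau> \<odot> J_hat"
    unfolding J_hat_def by (rule monoid_hom_conv[OF hom_antipode_id]) simp_all
  finally have hat: "(l \<otimes> I) \<cdot> delta_J = F_hat \<odot> \<tau> \<odot> J_hat" .
  have "antipode_J = (v \<diamondop> l) \<diamondop> w" unfolding antipode_J_def by (rule conv_assoc[symmetric]) simp_all
  then have "antipode_J = w \<star>\<^bsub>op_monoid H\<^esub> (l \<star>\<^bsub>op_monoid H\<^esub> v)"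
    by (simp add: conv_op_point)
  moreover have "(l \<star>\<^bsub>op_monoid H\<^esub> v) \<otimes> I = (l \<otimes> I) \<odot> (v \<otimes> \<eta>\<^bsub>H\<^esub>)"
    by (simp add: conv_tensor)
  ultimately have lI: "antipode_J \<otimes> I = (w \<otimes> \<eta>\<^bsub>H\<^esub>) \<odot> ((l \<otimes> I) \<odot> (v \<otimes> \<eta>\<^bsub>H\<^esub>))"
    using conv_tensor_point_middle[of "op_monoid H" H w "\<eta>\<^bsub>H\<^esub>" "l \<star>\<^bsub>op_monoid H\<^esub> v" I] by simp
  have "((w \<otimes> \<eta>\<^bsub>H\<^esub>) \<odot> ((l \<otimes> I) \<odot> (v \<otimes> \<eta>\<^bsub>H\<^esub>))) \<cdot> delta_J = (w \<otimes> \<eta>\<^bsub>H\<^esub>) \<odot> (((l \<otimes> I) \<cdot> delta_J) \<odot> (v \<otimes> \<eta>\<^bsub>H\<^esub>))"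
    using conv_comp[of E "w \<otimes> \<eta>\<^bsub>H\<^esub>" "(l \<otimes> I) \<odot> (v \<otimes> \<eta>\<^bsub>H\<^esub>)" "\<one> \<K>" delta_J]
      conv_comp[of E "l \<otimes> I" "v \<otimes> \<eta>\<^bsub>H\<^esub>" delta_J "\<one> \<K>"] by simp
  then have e: "(antipode_J \<otimes> I) \<cdot> delta_J = (w \<otimes> \<eta>\<^bsub>H\<^esub>) \<odot> ((F_hat \<odot> \<tau> \<odot> J_hat) \<odot> (v \<otimes> \<eta>\<^bsub>H\<^esub>))"
    unfolding lI hat .
  show ?thesis
    unfolding e U_def W_def by (simp add: conv_assoc)
qed

text \<open>
  On elements: \<open>(a \<otimes> 1) F \<delta>(h) = T((a \<otimes> 1) W) \<delta>(h) = T(W \<odot> (a \<otimes> h))\<close>, by linearity,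
  \<open>T_W\<close> and \<open>T_right\<close>.
\<close>

lemma T_deformed:
  assumes [simp]: "x \<in> Arr C" "Cod C x = obj H \<otimes>\<^sub>o obj H"
  shows "(i1 \<bullet> delta_J) \<cdot> x = (T \<cdot> (W \<odot> x)) \<bullet> J"
proof -
  let ?id = "\<one> (obj H \<otimes>\<^sub>o obj H)"
  have "W \<odot> ?id = W \<odot> (i1 \<odot> i2)" by (simp add: first_second)
  also have "\<dots> = (W \<odot> i1) \<odot> i2" by (rule conv_assoc[symmetric]) simp_all
  also have "W \<odot> i1 = i1 \<bullet> W" by (simp add: conv_op_tensor_first)
  finally have "T \<cdot> (W \<odot> ?id) = (i1 \<bullet> F) \<bullet> \<delta>\<^bsub>H\<^esub>"
    by (simp add: T_right lin_linear T_W)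
  then have "i1 \<bullet> delta_J = (T \<cdot> (W \<odot> ?id)) \<bullet> J"
    by (simp add: delta_J_def conv_assoc)
  then have "(i1 \<bullet> delta_J) \<cdot> x = ((T \<cdot> (W \<odot> ?id)) \<cdot> x) \<bullet> J"
    using conv_comp[of B "T \<cdot> (W \<odot> ?id)" J x "\<one> \<K>"] by simp
  moreover have "W \<odot> x = (W \<odot> ?id) \<cdot> x"
    using conv_comp[of E W ?id "\<one> \<K>" x] by simp
  ultimately show ?thesis by simp
qed

text \<open>
  Left multiplication by \<open>u\<close> for \<open>\<odot>\<close> acts on the first leg from the right, so it commutes with
  multiplication by \<open>a \<otimes> 1\<close> from the left.
\<close>

lemma point_first_commute:
  assumes [simp]: "u \<in> Arr C" "Dom C u = \<K>" "Cod C u = obj H \<otimes>\<^sub>o obj H"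
    "f \<in> Arr C" "Cod C f = obj H \<otimes>\<^sub>o obj H"
  shows "u \<odot> (i1 \<bullet> f) = i1 \<bullet> (u \<odot> f)"
proof -
  let ?X = "Dom C f"
  let ?c = "sym_arr C (obj H) ?X"
  have sw: "i1 \<bullet> g = (g \<odot> i1) \<cdot> ?c"
    if "g \<in> Arr C" "Cod C g = obj H \<otimes>\<^sub>o obj H" "Dom C g = ?X" for g
    using that sym_sym[of "obj H" ?X] by (simp add: conv_op_tensor_first)
  have "u \<odot> (i1 \<bullet> f) = (u \<odot> (f \<odot> i1)) \<cdot> ?c"
    using conv_comp[of E u "f \<odot> i1" "\<one> \<K>" ?c] by (simp add: sw)
  also have "u \<odot> (f \<odot> i1) = (u \<odot> f) \<odot> i1" by (rule conv_assoc[symmetric]) simp_all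
  finally show ?thesis by (simp add: sw)
qed

text \<open>
  On elements: \<open>S((a \<otimes> h) F) = (a \<otimes> 1) (\<tau>(h) \<odot> W)\<close> by linearity and \<open>T_left\<close>, and
  \<open>U\<close> can be moved past \<open>a \<otimes> 1\<close>.
\<close>

lemma S_deformed:
  assumes [simp]: "x \<in> Arr C" "Cod C x = obj H \<otimes>\<^sub>o obj H"
  shows "(i1 \<bullet> ((antipode_J \<otimes> I) \<cdot> delta_J)) \<cdot> x = U \<odot> (S \<cdot> (x \<bullet> F))"
proof -
  let ?id = "\<one> (obj H \<otimes>\<^sub>o obj H)"
  have sec: "S \<cdot> (i2 \<bullet> F) = \<tau> \<odot> W"
    by (rule S_eqI) (simp_all add: T_left T_W)
  have "?id \<bullet> F = (i1 \<bullet> i2) \<bullet> F" by (simp add: first_second)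
  also have "\<dots> = i1 \<bullet> (i2 \<bullet> F)" by (rule conv_assoc) simp_all
  finally have "S \<cdot> (?id \<bullet> F) = i1 \<bullet> (\<tau> \<odot> W)"
    by (simp add: lin_linear sec)
  then have "U \<odot> (S \<cdot> (?id \<bullet> F)) = i1 \<bullet> ((antipode_J \<otimes> I) \<cdot> delta_J)"
    by (simp add: point_first_commute tau_deformed)
  then have "(i1 \<bullet> ((antipode_J \<otimes> I) \<cdot> delta_J)) \<cdot> x = (U \<odot> (S \<cdot> (?id \<bullet> F))) \<cdot> x" by simp
  also have "\<dots> = U \<odot> ((S \<cdot> (?id \<bullet> F)) \<cdot> x)"
    using conv_comp[of E U "S \<cdot> (?id \<bullet> F)" "\<one> \<K>" x] by simp
  also have "(S \<cdot> (?id \<bullet> F)) \<cdot> x = S \<cdot> (x \<bullet> F)"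
    using conv_comp[of B ?id F x "\<one> \<K>"] by simp
  finally show ?thesis .
qed

text \<open>
  \<open>T_deformed\<close> and \<open>S_deformed\<close> display maps that are inverse to each other, since \<open>W\<close>, \<open>U\<close> are
  inverse for \<open>\<odot>\<close>, \<open>F\<close>, \<open>J\<close> for \<open>\<bullet>\<close>, and \<open>T\<close>, \<open>S\<close> under composition.
\<close>

lemma deformed_antipode: "left_antipode C (H\<lparr>delta := delta_J\<rparr>) antipode_J"
proof -
  have "W \<odot> (U \<odot> \<tau> \<odot> W) = (W \<odot> U) \<odot> (\<tau> \<odot> W)" by (rule conv_assoc[symmetric]) simp_all
  then have "(i1 \<bullet> delta_J) \<cdot> (antipode_J \<otimes> I) \<cdot> delta_J = (i2 \<bullet> F) \<bullet> J"
    unfolding tau_deformed by (simp add: T_deformed W_U T_left T_W)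
  also have "\<dots> = i2 \<bullet> (F \<bullet> J)" by (rule conv_assoc) simp_all
  finally have 1: "(i1 \<bullet> delta_J) \<cdot> (antipode_J \<otimes> I) \<cdot> delta_J = i2" by (simp add: F_J)
  have "delta_J \<bullet> F = F \<bullet> \<delta>\<^bsub>H\<^esub>" by (simp add: delta_J_def conv_assoc J_F)
  moreover have "S \<cdot> (F \<bullet> \<delta>\<^bsub>H\<^esub>) = W \<odot> i2"
    by (rule S_eqI) (simp_all add: T_right T_W)
  moreover have "U \<odot> (W \<odot> i2) = (U \<odot> W) \<odot> i2" by (rule conv_assoc[symmetric]) simp_all
  ultimately have 2: "(i1 \<bullet> ((antipode_J \<otimes> I) \<cdot> delta_J)) \<cdot> delta_J = i2"
    by (simp add: S_deformed U_W)
  show ?thesis using 1 2 by (simp add: left_antipode_iff hom_iff)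
qed

text \<open>
  Conjugation by \<open>J\<close> preserves products because \<open>J J\<inverse>\<close> cancels between two factors; the counit
  equations are those of \<open>\<delta>\<close> and the conormality of \<open>J\<close> and \<open>J\<inverse>\<close>.
\<close>

lemma deformed_bimonoid: "noncoassoc_bimonoid C (H\<lparr>delta := delta_J\<rparr>)"
proof -
  have counits: "(\<epsilon>\<^bsub>H\<^esub> \<otimes> I) \<cdot> delta_J = I" "(I \<otimes> \<epsilon>\<^bsub>H\<^esub>) \<cdot> delta_J = I"
    by (simp_all add: delta_J_def counit_conv[OF monoid_H hom_eps] conormal_F conormal_J)
  have "delta_J \<cdot> \<eta>\<^bsub>H\<^esub> = F \<bullet> ((\<delta>\<^bsub>H\<^esub> \<bullet> J) \<cdot> \<eta>\<^bsub>H\<^esub>)"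
    unfolding delta_J_def using conv_comp[of B F "\<delta>\<^bsub>H\<^esub> \<bullet> J" "\<one> \<K>" "\<eta>\<^bsub>H\<^esub>"] by simp
  also have "(\<delta>\<^bsub>H\<^esub> \<bullet> J) \<cdot> \<eta>\<^bsub>H\<^esub> = J"
    using conv_comp[of B "\<delta>\<^bsub>H\<^esub>" J "\<eta>\<^bsub>H\<^esub>" "\<one> \<K>"] by simp
  finally have unit: "delta_J \<cdot> \<eta>\<^bsub>H\<^esub> = \<eta>\<^bsub>H\<^esub> \<otimes> \<eta>\<^bsub>H\<^esub>" by (simp add: F_J)
  have "delta_J \<cdot> \<mu>\<^bsub>H\<^esub> = F \<bullet> ((\<delta>\<^bsub>H\<^esub> \<bullet> J) \<cdot> \<mu>\<^bsub>H\<^esub>)"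
    unfolding delta_J_def using conv_comp[of B F "\<delta>\<^bsub>H\<^esub> \<bullet> J" "\<one> \<K>" "\<mu>\<^bsub>H\<^esub>"] by simp
  also have "(\<delta>\<^bsub>H\<^esub> \<bullet> J) \<cdot> \<mu>\<^bsub>H\<^esub> = (\<delta>\<^bsub>H\<^esub> \<bullet> \<delta>\<^bsub>H\<^esub>) \<bullet> J"
    using conv_comp[of B "\<delta>\<^bsub>H\<^esub>" J "\<mu>\<^bsub>H\<^esub>" "\<one> \<K>"] hom_delta by (simp add: monoid_hom_def)
  also have "F \<bullet> ((\<delta>\<^bsub>H\<^esub> \<bullet> \<delta>\<^bsub>H\<^esub>) \<bullet> J) = F \<bullet> \<delta>\<^bsub>H\<^esub> \<bullet> (J \<bullet> F) \<bullet> \<delta>\<^bsub>H\<^esub> \<bullet> J"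
    unfolding J_F by (simp add: conv_assoc)
  also have "\<dots> = delta_J \<bullet> delta_J"
    by (simp add: delta_J_def conv_assoc)
  finally have mult: "delta_J \<cdot> \<mu>\<^bsub>H\<^esub> = \<mu>\<^bsub>B\<^esub> \<cdot> (delta_J \<otimes> delta_J)" by (simp add: conv_def)
  have tens: "tensor_monoid C (H\<lparr>delta := delta_J\<rparr>) (H\<lparr>delta := delta_J\<rparr>) = B"
    by (simp add: tensor_monoid_def)
  have "monoid_in C (H\<lparr>delta := delta_J\<rparr>)"
    using monoid_H unfolding monoid_in_def by simp
  moreover have "counital_comagma C (H\<lparr>delta := delta_J\<rparr>)"
    by (simp add: counital_comagma_def hom_iff counits)
  moreover have "\<epsilon>\<^bsub>H\<^esub> \<cdot> \<mu>\<^bsub>H\<^esub> = \<epsilon>\<^bsub>H\<^esub> \<otimes> \<epsilon>\<^bsub>H\<^esub>"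
    using bimonoid by (simp add: noncoassoc_bimonoid_def)
  ultimately show ?thesis
    by (simp add: noncoassoc_bimonoid_def tens unit mult)
qed

end

theorem theorem3p1p15:
  fixes C :: "('o, 'm) smcat" (structure)
    and H :: "('o, 'm) bimonoid_data"
    and l J v v_inv :: 'm
  assumes "strict_symmetric_monoidal_category C"
    and "left_Hopf_coquasigroup C H"
    and "left_antipode C H l"
    and "twist C H J"
    and "conormal C H J"
    and "v = \<mu>\<^bsub>H\<^esub> \<cdot> (\<one> (obj H) \<otimes> l) \<cdot> twist_inv C H J"
    and "v_inv = \<mu>\<^bsub>H\<^esub> \<cdot> (l \<otimes> \<one> (obj H)) \<cdot> J"
  shows "conv_inverse_of C H v v_inv \<and>
    left_Hopf_coquasigroup C (twist_deformation C H J) \<and>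
    left_antipode C (twist_deformation C H J) (\<mu>\<^bsub>H\<^esub> \<cdot> (v \<otimes> (\<mu>\<^bsub>H\<^esub> \<cdot> (l \<otimes> v_inv))))"
proof -
  interpret ssm: strict_symmetric_monoidal_category C by (rule assms)
  interpret X: twisted_left_Hopf C H l J
    using assms by unfold_locales (auto simp: left_Hopf_coquasigroup_def)
  have v: "v = X.v" and v_inv: "v_inv = X.w"
    using assms(6,7) by (simp_all add: X.v_def X.w_def X.F_def)
  have "conv_inverse_of C H v v_inv"
    unfolding v v_inv conv_inverse_of_def using X.v_w X.w_v by (simp add: ssm.hom_iff)
  moreover have "\<mu>\<^bsub>H\<^esub> \<cdot> (v \<otimes> (\<mu>\<^bsub>H\<^esub> \<cdot> (l \<otimes> v_inv))) = X.antipode_J"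
    by (simp add: v v_inv X.antipode_J_def conv_def)
  ultimately show ?thesis
    using X.deformed_bimonoid X.deformed_antipode
    by (auto simp: X.twist_deformation_eq left_Hopf_coquasigroup_def)
qed

end
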